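(* For any connected graph $G$, $f(G)\le \tfrac12 c_2(G)$.
   Context: Equality problem on a graph: let $G=(V,E)$ be a connected undirected graph. On each vertex of $G$ sits a player holding an $n$-bit string. Players may communicate only with their neighbours in $G$ (sending bits along edges), according to a fixed deterministic communication protocol, and at the end the players must decide, correctly for every input, whether all their input strings are equal. The cost of a protocol is the total number of bits transmitted (over all edges, in the worst case over inputs). Let $f(n,G)$ denote the minimum cost of a protocol solving this problem on $G$ for $n$-bit inputs, and let $f(G)=\lim_{n\to\infty} f(n,G)/n$ (this limit exists by subadditivity). For a connected graph $G$, $c_2(G)$ denotes the minimum number of edges in a $2$-edge-connected spanning subgraph of $G$, where the subgraph is allowed to be a multigraph containing the same edge of $G$ twice (each edge of $G$ used at most twice). E.g. for a tree $G$ on $k$ vertices $c_2(G)=2(k-1)$, and for a graph $G$ on $k$ vertices $c_2(G)=k$ iff $G$ is Hamiltonian. *)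

theory Defs
  imports Complex_Main "HOL-Library.Multiset"
begin

section \<open>Graphs\<close>

text \<open>An undirected simple graph is a finite vertex set with a set of two-element vertex sets.\<close>

definition simple_graph :: "'v set \<Rightarrow> 'v set set \<Rightarrow> bool" where
  "simple_graph V E \<longleftrightarrow> finite V \<and> (\<forall>e\<in>E. e \<subseteq> V \<and> card e = 2)"

definition graph_connected :: "'v set \<Rightarrow> 'v set set \<Rightarrow> bool" where
  "graph_connected V E \<longleftrightarrow> V \<noteq> {} \<and> (\<forall>u\<in>V. \<forall>v\<in>V. (u, v) \<in> {(a, b). {a, b} \<in> E}\<^sup>*)"

text \<open>A multigraph on \<open>V\<close> is given by the multiset of its edges; removing \<open>{#e#}\<close> deletes
  a single copy of \<open>e\<close>.  The one-vertex graph without edges counts as 2-edge-connected, so that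
  a tree on \<open>k\<close> vertices has \<open>c2 = 2 * (k - 1)\<close> also for \<open>k = 1\<close>.\<close>

definition two_edge_connected :: "'v set \<Rightarrow> 'v set multiset \<Rightarrow> bool" where
  "two_edge_connected V M \<longleftrightarrow> graph_connected V (set_mset M) \<and>
     (\<forall>e\<in>#M. graph_connected V (set_mset (M - {#e#})))"

definition c2 :: "'v set \<Rightarrow> 'v set set \<Rightarrow> nat" where
  "c2 V E = (LEAST k. \<exists>M. size M = k \<and> set_mset M \<subseteq> E \<and> (\<forall>e. count M e \<le> 2) \<and>
     two_edge_connected V M)"

section \<open>Communication protocols\<close>

text \<open>
  A protocol prescribes for every player, as a function of nothing but the player's own input and
  the sequence of bits the player has sent and received so far, what the player does next: send a
  bit to a neighbour, wait for the next bit from a particular neighbour, or stop with an answer.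
  The order of communication may thus depend on the inputs.  Channels are first-in first-out, and
  a player cannot observe that a message has not arrived, so that silence carries no information.
\<close>

datatype 'v action = Send 'v bool | Receive 'v | Output bool

datatype 'v event = is_Sent: Sent 'v bool | Received 'v bool

type_synonym 'v protocol = "'v \<Rightarrow> bool list \<Rightarrow> 'v event list \<Rightarrow> 'v action"

definition sent_to :: "'v \<Rightarrow> 'v event list \<Rightarrow> bool list" where
  "sent_to v h = [b. Sent w b \<leftarrow> h, w = v]"

definition received_from :: "'v \<Rightarrow> 'v event list \<Rightarrow> bool list" where
  "received_from u h = [b. Received w b \<leftarrow> h, w = u]"

text \<open>A state of the execution is the family \<open>h\<close> of the histories of all players; the bits in
  transit from \<open>u\<close> to \<open>v\<close> are those in \<open>sent_to v (h u)\<close> beyond \<open>received_from u (h v)\<close>.\<close>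

inductive step ::
    "'v set set \<Rightarrow> 'v protocol \<Rightarrow> ('v \<Rightarrow> bool list) \<Rightarrow>
     ('v \<Rightarrow> 'v event list) \<Rightarrow> ('v \<Rightarrow> 'v event list) \<Rightarrow> bool"
  for E :: "'v set set" and P :: "'v protocol" and x :: "'v \<Rightarrow> bool list"
where
  send: "\<lbrakk>P u (x u) (h u) = Send v b; {u, v} \<in> E\<rbrakk>
    \<Longrightarrow> step E P x h (h(u := h u @ [Sent v b]))"
| receive: "\<lbrakk>P v (x v) (h v) = Receive u; {u, v} \<in> E;
     sent_to v (h u) = received_from u (h v) @ b # bs\<rbrakk>
    \<Longrightarrow> step E P x h (h(v := h v @ [Received u b]))"

definition complete_run ::
    "'v set \<Rightarrow> 'v set set \<Rightarrow> 'v protocol \<Rightarrow> ('v \<Rightarrow> bool list) \<Rightarrow> ('v \<Rightarrow> 'v event list) \<Rightarrow> bool" where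
  "complete_run V E P x h \<longleftrightarrow>
     (step E P x)\<^sup>*\<^sup>* (\<lambda>_. []) h \<and> (\<forall>v\<in>V. \<exists>a. P v (x v) (h v) = Output a)"

definition inputs :: "'v set \<Rightarrow> nat \<Rightarrow> ('v \<Rightarrow> bool list) set" where
  "inputs V n = {x. \<forall>v\<in>V. length (x v) = n}"

text \<open>All players have to output the correct answer, and every bit sent has to be received.
  Asking for one complete run is no restriction on the scheduling: by \<open>complete_run_confluent\<close>
  below, every other execution can be continued to that same run.\<close>

definition solves_equality :: "'v set \<Rightarrow> 'v set set \<Rightarrow> nat \<Rightarrow> 'v protocol \<Rightarrow> bool" where
  "solves_equality V E n P \<longleftrightarrow> (\<forall>x\<in>inputs V n. \<exists>h. complete_run V E P x h \<and>
     (\<forall>v\<in>V. P v (x v) (h v) = Output (\<forall>u\<in>V. \<forall>w\<in>V. x u = x w)) \<and>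
     (\<forall>u\<in>V. \<forall>v\<in>V. received_from u (h v) = sent_to v (h u)))"

definition bits_transmitted :: "'v set \<Rightarrow> ('v \<Rightarrow> 'v event list) \<Rightarrow> nat" where
  "bits_transmitted V h = (\<Sum>v\<in>V. length (filter is_Sent (h v)))"

definition cost_at_most :: "'v set \<Rightarrow> 'v set set \<Rightarrow> nat \<Rightarrow> 'v protocol \<Rightarrow> nat \<Rightarrow> bool" where
  "cost_at_most V E n P c \<longleftrightarrow>
     (\<forall>x\<in>inputs V n. \<forall>h. complete_run V E P x h \<longrightarrow> bits_transmitted V h \<le> c)"

definition equality_cost :: "nat \<Rightarrow> 'v set \<Rightarrow> 'v set set \<Rightarrow> nat" where
  "equality_cost n V E = (LEAST c. \<exists>P. solves_equality V E n P \<and> cost_at_most V E n P c)"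

definition equality_rate :: "'v set \<Rightarrow> 'v set set \<Rightarrow> real" where
  "equality_rate V E = lim (\<lambda>n. real (equality_cost n V E) / real n)"

section \<open>Independence of the schedule\<close>

lemma sent_to_snoc:
  "sent_to v (h @ [Sent w b]) = sent_to v h @ (if w = v then [b] else [])"
  "sent_to v (h @ [Received w b]) = sent_to v h"
  by (simp_all add: sent_to_def)

lemma received_from_snoc:
  "received_from v (h @ [Received w b]) = received_from v h @ (if w = v then [b] else [])"
  "received_from v (h @ [Sent w b]) = received_from v h"
  by (simp_all add: received_from_def)

lemma sent_to_update:
  assumes "step E P x h h'"
  shows "\<exists>bs. sent_to v (h' u) = sent_to v (h u) @ bs"
  using assms by cases (auto simp: sent_to_snoc)

lemma step_acting:
  "step E P x h h' \<longleftrightarrow> (\<exists>u e. h' = h(u := h u @ [e]) \<and>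
     ((\<exists>v b. e = Sent v b \<and> P u (x u) (h u) = Send v b \<and> {u, v} \<in> E) \<or>
      (\<exists>w b bs. e = Received w b \<and> P u (x u) (h u) = Receive w \<and> {w, u} \<in> E \<and>
         sent_to u (h w) = received_from w (h u) @ b # bs)))"
  by (auto simp: step.simps; blast)

lemma step_other:
  assumes a: "step E P x h (h(u := h u @ [e]))" and b: "step E P x h h'" and same: "h' u = h u"
  shows "step E P x h' (h'(u := h u @ [e]))"
proof -
  from a obtain u' e' where eq: "h(u := h u @ [e]) = h(u' := h u' @ [e'])"
    and c: "(\<exists>v b. e' = Sent v b \<and> P u' (x u') (h u') = Send v b \<and> {u', v} \<in> E) \<or>
      (\<exists>w b bs. e' = Received w b \<and> P u' (x u') (h u') = Receive w \<and> {w, u'} \<in> E \<and>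
         sent_to u' (h w) = received_from w (h u') @ b # bs)"
    unfolding step_acting by blast
  have "u' = u \<and> e' = e"
    using fun_cong[OF eq, of u] by (auto split: if_splits)
  then have ue: "u' = u" "e' = e" by auto
  from c show ?thesis
  proof (elim disjE exE conjE)
    fix v b assume "e' = Sent v b" "P u' (x u') (h u') = Send v b" "{u', v} \<in> E"
    then show ?thesis using ue same step.send[of P u x h' v b E] by simp
  next
    fix w c bs
    assume *: "e' = Received w c" "P u' (x u') (h u') = Receive w" "{w, u'} \<in> E"
      "sent_to u' (h w) = received_from w (h u') @ c # bs"
    obtain cs where "sent_to u (h' w) = sent_to u (h w) @ cs"
      using sent_to_update[OF b] by blast
    then have "sent_to u (h' w) = received_from w (h' u) @ c # (bs @ cs)"
      using * ue same by simp
    then show ?thesis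
      using * ue same step.receive[of P u x h' w E c "bs @ cs"] by simp
  qed
qed

lemma step_diamond:
  assumes "step E P x h h1" "step E P x h h2" "h1 \<noteq> h2"
  shows "\<exists>h3. step E P x h1 h3 \<and> step E P x h2 h3"
proof -
  obtain u e where 1: "h1 = h(u := h u @ [e])"
    and c1: "(\<exists>v b. e = Sent v b \<and> P u (x u) (h u) = Send v b \<and> {u, v} \<in> E) \<or>
      (\<exists>w b bs. e = Received w b \<and> P u (x u) (h u) = Receive w \<and> {w, u} \<in> E \<and>
         sent_to u (h w) = received_from w (h u) @ b # bs)"
    using assms(1) unfolding step_acting by blast
  obtain v d where 2: "h2 = h(v := h v @ [d])"
    and c2: "(\<exists>v' b. d = Sent v' b \<and> P v (x v) (h v) = Send v' b \<and> {v, v'} \<in> E) \<or>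
      (\<exists>w b bs. d = Received w b \<and> P v (x v) (h v) = Receive w \<and> {w, v} \<in> E \<and>
         sent_to v (h w) = received_from w (h v) @ b # bs)"
    using assms(2) unfolding step_acting by blast
  have "u \<noteq> v"
  proof
    assume "u = v"
    then have "e = d" using c1 c2 by auto
    with \<open>u = v\<close> 1 2 assms(3) show False by simp
  qed
  then have "step E P x h1 (h1(v := h v @ [d]))" "step E P x h2 (h2(u := h u @ [e]))"
    using step_other[of E P x h v d h1] step_other[of E P x h u e h2] assms 1 2 by auto
  moreover have "h1(v := h v @ [d]) = h2(u := h u @ [e])"
    using \<open>u \<noteq> v\<close> 1 2 by auto
  ultimately show ?thesis by metis
qed

lemma step_into_stuck:
  assumes "(step E P x)\<^sup>*\<^sup>* h0 h" "\<And>h'. \<not> step E P x h h'" "step E P x h0 h1"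
  shows "(step E P x)\<^sup>*\<^sup>* h1 h"
  using assms(1,3)
proof (induction arbitrary: h1 rule: converse_rtranclp_induct)
  case base
  then show ?case using assms(2) by blast
next
  case (step y z)
  show ?case
  proof (cases "z = h1")
    case True
    then show ?thesis using step by simp
  next
    case False
    then obtain h3 where "step E P x z h3" "step E P x h1 h3"
      using step_diamond step by metis
    then show ?thesis using step.IH by (meson converse_rtranclp_into_rtranclp)
  qed
qed

lemma complete_run_stuck:
  assumes "simple_graph V E" "complete_run V E P x h"
  shows "\<not> step E P x h h'"
proof
  assume "step E P x h h'"
  then have "\<exists>u. (\<forall>a. P u (x u) (h u) \<noteq> Output a) \<and> (\<exists>e\<in>E. u \<in> e)"
  proof cases
    case (send u v b)
    then show ?thesis by (intro exI[of _ u]) auto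
  next
    case (receive v u b bs)
    then show ?thesis by (intro exI[of _ v]) auto
  qed
  then show False
    using assms unfolding simple_graph_def complete_run_def by blast
qed

theorem complete_run_confluent:
  assumes "simple_graph V E" "complete_run V E P x h" "(step E P x)\<^sup>*\<^sup>* (\<lambda>_. []) h'"
  shows "(step E P x)\<^sup>*\<^sup>* h' h"
  using assms(3)
proof (induction rule: rtranclp_induct)
  case base
  then show ?case using assms(2) by (simp add: complete_run_def)
next
  case (step y z)
  then show ?case using step_into_stuck complete_run_stuck[OF assms(1,2)] by metis
qed

corollary complete_run_unique:
  assumes "simple_graph V E" "complete_run V E P x h" "complete_run V E P x h'"
  shows "h = h'"
proof -
  have "(step E P x)\<^sup>*\<^sup>* h' h"
    using assms complete_run_confluent unfolding complete_run_def by blast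
  then show ?thesis
    using complete_run_stuck[OF assms(1,3)] by (metis converse_rtranclpE)
qed

end

theory Submission
  imports Defs "HOL-Library.FuncSet"
begin

text \<open>Take a 2-edge-connected subgraph and decompose it into ears. Inputs of \<open>2d\<^sup>2 - O(d)\<close> bits are
  encoded as pairs \<open>(a, b)\<close> of vectors in \<open>{0..<2\<^sup>d}\<^sup>d\<close> with \<open>b\<close> on a fixed sphere, which exists
  by pigeonhole as in Behrend's construction. Across the \<open>i\<close>-th edge of an ear
  one player sends \<open>a + i * b\<close>, which takes only \<open>d\<^sup>2 + O(d)\<close> bits, and the other compares it with its
  own value. If no comparison fails, strict convexity of the sphere makes all
  inputs on an ear equal. A constant number of further bits spreads the verdict. This
  gives the bound for infinitely many input lengths, and by subadditivity the limit is the infimum.\<close>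

section \<open>Subadditive sequences\<close>

text \<open>The coefficient in \<open>a + i * b\<close> grows along an ear so that adding all
  agreements cancels \<open>a\<close> at the inner vertices. The sum closes up only if the two ends
  agree, which is why ears are attached one by one to a set of vertices already known to agree.

  The linear conditions alone would accept distinct \<open>b\<close> with the right average; the
  sphere is the extra restriction that rules this out. Its price is the logarithm of the number of
  possible squared norms. With \<open>d\<close> coordinates in \<open>{0..<2^d}\<close> these norms
  lie below \<open>2^(3*d)\<close>, so some sphere keeps \<open>d*d - 3*d\<close> of the
  \<open>d*d\<close> bits of \<open>b\<close>. The coefficients lengthen every coordinate by a
  constant number of bits. Many coordinates make the first loss negligible and long coordinates the
  second, so both parameters have to grow.

  A failed comparison is noticed by its receiver alone. As the schedule is fixed in advance, the
  alarm has to travel from every possible vertex to every other, but the number of bits for this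
  depends on the graph only.\<close>

lemma subadditive_mult_le:
  fixes f :: "nat \<Rightarrow> real"
  assumes "\<And>m n. f (m + n) \<le> f m + f n"
  shows "f (q * k + r) \<le> real q * f k + f r"
proof (induction q)
  case (Suc q)
  have "f (Suc q * k + r) \<le> f k + f (q * k + r)"
    using assms[of k "q * k + r"] by (simp add: add.assoc)
  then show ?case using Suc by (simp add: algebra_simps)
qed simp

text \<open>\<open>equality_rate\<close> is a \<open>lim\<close>, which is informative only once
  convergence is known. The second conclusion makes sparse lengths sufficient: every single quotient
  bounds the limit from above.\<close>

lemma fekete:
  fixes f :: "nat \<Rightarrow> real"
  assumes nonneg: "\<And>n. 0 \<le> f n" and sub: "\<And>m n. f (m + n) \<le> f m + f n"
  obtains L where "(\<lambda>n. f n / real n) \<longlonglongrightarrow> L" "\<And>k. 1 \<le> k \<Longrightarrow> L \<le> f k / real k"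
proof
  define L where "L = (INF k\<in>{1..}. f k / real k)"
  have bdd: "bdd_below ((\<lambda>k. f k / real k) ` {1..})"
    using nonneg by (intro bdd_belowI[of _ 0]) auto
  show lower: "L \<le> f k / real k" if "1 \<le> k" for k
    unfolding L_def using that by (intro cINF_lower[OF bdd]) auto
  show "(\<lambda>n. f n / real n) \<longlonglongrightarrow> L"
  proof (rule order_tendstoI)
    fix a assume "a < L"
    then have "\<forall>n\<ge>1. a < f n / real n" using lower less_le_trans by blast
    then show "\<forall>\<^sub>F n in sequentially. a < f n / real n"
      unfolding eventually_sequentially by blast
  next
    fix a assume "L < a"
    then obtain k where k: "1 \<le> k" "f k / real k < a"
      unfolding L_def using cINF_less_iff[OF _ bdd] by auto
    \<comment> \<open>Bounds the remainder term \<open>f (n mod k)\<close> independently of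
      \<open>n\<close>, so that its share \<open>C / n\<close> vanishes.\<close>
    define C where "C = (\<Sum>r<k. f r)"
    have C: "f r \<le> C" if "r < k" for r
      unfolding C_def using nonneg that by (intro member_le_sum) auto
    have "(\<lambda>n. f k / real k + C / real n) \<longlonglongrightarrow> f k / real k + 0"
      by (intro tendsto_add tendsto_const lim_const_over_n)
    then have "\<forall>\<^sub>F n in sequentially. f k / real k + C / real n < a"
      using k by (intro order_tendstoD(2)[of _ "f k / real k + 0"]) auto
    moreover have "\<forall>\<^sub>F n in sequentially. f n / real n \<le> f k / real k + C / real n"
      unfolding eventually_sequentially
    proof (intro exI[of _ 1] allI impI)
      fix n :: nat assume n: "1 \<le> n"
      have "f n \<le> real (n div k) * f k + f (n mod k)"
        using subadditive_mult_le[of f "n div k" k "n mod k", OF sub] by simp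
      also have "\<dots> \<le> real n / real k * f k + C"
        using nonneg[of k] C[of "n mod k"] k of_nat_div_le_of_nat[of n k, where 'a = real]
        by (intro add_mono mult_right_mono) auto
      finally show "f n / real n \<le> f k / real k + C / real n"
        using n k by (simp add: field_simps)
    qed
    ultimately show "\<forall>\<^sub>F n in sequentially. f n / real n < a"
      by eventually_elim linarith
  qed
qed

section \<open>Ears\<close>

lemma mset_subset_eq_of_distinct:
  "distinct xs \<Longrightarrow> set xs \<subseteq> set_mset M \<Longrightarrow> mset xs \<subseteq># M"
  by (intro mset_subset_eqI) (auto simp: distinct_count_atmost_1 Suc_le_eq)

text \<open>In a walk of least length from \<open>u\<close> into \<open>S\<close>, an earlier visit
  to \<open>S\<close> or a repeated vertex would allow a shortcut.\<close>

lemma relpow_shortest_path: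
  assumes "(u, s) \<in> R\<^sup>*" "s \<in> S"
  obtains f n where "f 0 = u" "f n \<in> S" "\<And>i. i < n \<Longrightarrow> (f i, f (Suc i)) \<in> R"
    "\<And>i. i < n \<Longrightarrow> f i \<notin> S" "inj_on f {..n}"
proof -
  let ?P = "\<lambda>n. \<exists>s\<in>S. (u, s) \<in> R ^^ n"
  define n where "n = (LEAST n. ?P n)"
  have ex: "\<exists>n. ?P n" using assms rtrancl_imp_relpow by blast
  have Pn: "?P n" unfolding n_def by (rule LeastI_ex[OF ex])
  have least: "n \<le> k" if "?P k" for k unfolding n_def using that by (rule Least_le)
  from Pn obtain f where f: "f 0 = u" "f n \<in> S" "\<And>i. i < n \<Longrightarrow> (f i, f (Suc i)) \<in> R"
    unfolding relpow_fun_conv by blast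
  have reach: "(u, f i) \<in> R ^^ i" if "i \<le> n" for i
    unfolding relpow_fun_conv using f that by (intro exI[of _ f]) auto
  have "f i \<notin> S" if "i < n" for i
    using least[of i] reach[of i] that by auto
  moreover have "inj_on f {..n}"
  proof (rule linorder_inj_onI)
    fix i j assume "i < j" "i \<in> {..n}" "j \<in> {..n}"
    then have ij: "i < j" "j \<le> n" by auto
    show "f i \<noteq> f j"
    proof
      assume eq: "f i = f j"
      have "(f j, f n) \<in> R ^^ (n - j)"
        unfolding relpow_fun_conv using f ij by (intro exI[of _ "\<lambda>k. f (j + k)"]) auto
      then have "(u, f n) \<in> R ^^ i O R ^^ (n - j)"
        using reach[of i] ij eq by auto
      then have "(u, f n) \<in> R ^^ (i + (n - j))" by (simp only: relpow_add)
      then show False using least[of "i + (n - j)"] f(2) ij by force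
    qed
  qed auto
  ultimately show thesis using that f by blast
qed

lemma connected_leaving_edge:
  assumes "graph_connected V F" "S \<subseteq> V" "S \<noteq> {}" "S \<noteq> V"
  obtains s u where "s \<in> S" "u \<notin> S" "{s, u} \<in> F"
proof -
  obtain s v where sv: "s \<in> S" "v \<in> V" "v \<notin> S" using assms by blast
  have "(s, v) \<in> {(a, b). {a, b} \<in> F}\<^sup>*"
    using assms sv unfolding graph_connected_def by blast
  then have "v \<in> S \<or> (\<exists>s u. s \<in> S \<and> u \<notin> S \<and> {s, u} \<in> F)"
    by (induction rule: rtrancl_induct) (use sv in auto)
  then show thesis using that sv by blast
qed

text \<open>Delete one copy of an edge from \<open>s\<close> in \<open>S\<close> to \<open>u\<close>
  outside. What remains is connected, so a shortest path leads from \<open>u\<close> back to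
  \<open>S\<close>; the edge followed by this path is the ear. The way back may use a second copy of
  the same edge, and the two ends of the ear may coincide.\<close>

lemma two_edge_connected_ear:
  assumes conn: "two_edge_connected V M" and M: "\<And>e. e \<in># M \<Longrightarrow> e \<subseteq> V"
    and S: "S \<subseteq> V" "S \<noteq> {}" "S \<noteq> V"
  obtains w r where "1 \<le> r" "w 0 \<in> S" "w (Suc r) \<in> S"
    "\<And>i. 1 \<le> i \<Longrightarrow> i \<le> r \<Longrightarrow> w i \<in> V - S"
    "mset (map (\<lambda>i. {w i, w (Suc i)}) [0..<Suc r]) \<subseteq># M"
proof -
  obtain s u where su: "s \<in> S" "u \<notin> S" "{s, u} \<in># M"
    using connected_leaving_edge[of V "set_mset M" S] conn S
    unfolding two_edge_connected_def by blast
  let ?M = "M - {#{s, u}#}"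
  let ?R = "{(a, b). {a, b} \<in># ?M}"
  have "u \<in> V" using M su by blast
  then have "(u, s) \<in> ?R\<^sup>*"
    using conn su S unfolding two_edge_connected_def graph_connected_def by blast
  then obtain f n where f: "f 0 = u" "f n \<in> S" "\<And>i. i < n \<Longrightarrow> (f i, f (Suc i)) \<in> ?R"
    "\<And>i. i < n \<Longrightarrow> f i \<notin> S" "inj_on f {..n}"
    using relpow_shortest_path[of u s ?R S] su by blast
  define w where "w = case_nat s f"
  have "1 \<le> n" using f su by (cases n) auto
  moreover have "w 0 \<in> S" "w (Suc n) \<in> S" using su f by (auto simp: w_def)
  moreover have "w i \<in> V - S" if i: "1 \<le> i" "i \<le> n" for i
  proof -
    obtain j where j: "i = Suc j" "j < n" using i by (cases i) auto
    have "{f j, f (Suc j)} \<in># M" using f(3)[OF j(2)] by (auto dest: in_diffD)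
    then show ?thesis using M f(4)[OF j(2)] j by (auto simp: w_def)
  qed
  \<comment> \<open>Containment has to respect multiplicities: the path has distinct edges inside
    \<open>?M\<close>, and the deleted copy pays for the first edge of the ear.\<close>
  moreover have "mset (map (\<lambda>i. {w i, w (Suc i)}) [0..<Suc n]) \<subseteq># M"
  proof -
    let ?es = "map (\<lambda>i. {f i, f (Suc i)}) [0..<n]"
    have "distinct ?es"
      unfolding distinct_map
    proof (intro conjI linorder_inj_onI)
      fix i j assume ij: "i < j" "i \<in> set [0..<n]" "j \<in> set [0..<n]"
      then have "f i \<noteq> f j" "f i \<noteq> f (Suc j)"
        using inj_onD[OF f(5), of i j] inj_onD[OF f(5), of i "Suc j"] by auto
      then show "{f i, f (Suc i)} \<noteq> {f j, f (Suc j)}" by (auto simp: doubleton_eq_iff)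
    qed auto
    moreover have "set ?es \<subseteq> set_mset ?M" using f(3) by auto
    ultimately have "mset ?es \<subseteq># ?M" by (rule mset_subset_eq_of_distinct)
    then have "add_mset {s, u} (mset ?es) \<subseteq># M"
      using su(3) by (metis add_mset_remove_trivial_If insert_DiffM mset_subset_eq_add_mset_cancel)
    moreover have "map (\<lambda>i. {w i, w (Suc i)}) [0..<Suc n] = {s, u} # ?es"
      using f(1) by (simp add: w_def upt_conv_Cons map_Suc_upt[symmetric] del: upt_Suc)
    ultimately show ?thesis by simp
  qed
  ultimately show thesis by (rule that)
qed

text \<open>A player with input \<open>(a, b)\<close> evaluates the linear form \<open>a + i * b\<close> at the \<open>i\<close>-th edge of an ear.
  Summing the agreements along an ear whose two ends hold the same input cancels \<open>a\<close> and
  exhibits the \<open>b\<close> at the ends as the average of the inner ones. On a sphere this forces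
  equality.\<close>

lemma ear_rigid:
  fixes a b :: "nat \<Rightarrow> nat \<Rightarrow> int"
  assumes norm: "\<And>i. i \<le> Suc r \<Longrightarrow> (\<Sum>c<d. (b i c)\<^sup>2) = R"
    and ends: "\<And>c. c < d \<Longrightarrow> a (Suc r) c = a 0 c \<and> b (Suc r) c = b 0 c"
    and agree: "\<And>i c. i \<le> r \<Longrightarrow> c < d \<Longrightarrow> a i c + int i * b i c = a (Suc i) c + int i * b (Suc i) c"
    and "i \<le> Suc r" "c < d"
  shows "a i c = a 0 c \<and> b i c = b 0 c"
proof -
  \<comment> \<open>Adding the agreements for \<open>0..j\<close>: the coefficient rises by one from
    edge to edge, which cancels every inner \<open>a\<close> and leaves exactly one copy of each
    inner \<open>b\<close>.\<close>
  have tele: "a 0 c + (\<Sum>i=1..j. b i c) = a (Suc j) c + int j * b (Suc j) c"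
    if "j \<le> r" "c < d" for j c
    using that
  proof (induction j)
    case 0
    then show ?case using agree[of 0 c] by simp
  next
    case (Suc j)
    then show ?case using agree[of "Suc j" c] by (simp add: algebra_simps)
  qed
  have avg: "(\<Sum>i=1..r. b i c) = int r * b 0 c" if "c < d" for c
    using tele[of r c] ends that by simp
  \<comment> \<open>Strict convexity in algebraic form: on the sphere the squared distances to
    \<open>b 0\<close> sum to \<open>2 * r * R\<close> minus twice the inner product of
    \<open>b 0\<close> with the sum of the inner \<open>b i\<close>. That sum is
    \<open>r * b 0\<close>, so the total is zero.\<close>
  have "(\<Sum>i=1..r. \<Sum>c<d. (b i c - b 0 c)\<^sup>2)
      = (\<Sum>i=1..r. \<Sum>c<d. (b i c)\<^sup>2 + (b 0 c)\<^sup>2 - 2 * (b 0 c * b i c))"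
    by (simp add: power2_diff algebra_simps)
  also have "\<dots> = (\<Sum>i=1..r. 2 * R - (\<Sum>c<d. 2 * (b 0 c * b i c)))"
    using norm by (intro sum.cong refl) (simp add: sum.distrib sum_subtractf)
  also have "\<dots> = 2 * int r * R - (\<Sum>c<d. 2 * b 0 c * (\<Sum>i=1..r. b i c))"
    by (simp add: sum_subtractf sum.swap[of _ "{..<d}"] sum_distrib_left mult.assoc)
  also have "(\<Sum>c<d. 2 * b 0 c * (\<Sum>i=1..r. b i c)) = (\<Sum>c<d. 2 * int r * (b 0 c)\<^sup>2)"
    using avg by (intro sum.cong) (auto simp: power2_eq_square)
  also have "\<dots> = 2 * int r * R"
    using norm[of 0] by (simp add: sum_distrib_left[symmetric])
  finally have zero: "(\<Sum>i=1..r. \<Sum>c<d. (b i c - b 0 c)\<^sup>2) = 0" by simp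
  have b: "b i c = b 0 c" if "i \<le> Suc r" "c < d" for i c
  proof (cases "i \<in> {1..r}")
    case True
    have "(\<Sum>c<d. (b i c - b 0 c)\<^sup>2) = 0"
      using zero True by (subst (asm) sum_nonneg_eq_0_iff) (auto intro: sum_nonneg)
    then have "(b i c - b 0 c)\<^sup>2 = 0"
      using that by (subst (asm) sum_nonneg_eq_0_iff) auto
    then show ?thesis by simp
  next
    case False
    then have "i = 0 \<or> i = Suc r" using that by auto
    then show ?thesis using ends that by auto
  qed
  have "a i c = a 0 c" if "i \<le> Suc r" "c < d" for i c
    using that
  proof (induction i)
    case (Suc i)
    then show ?case using agree[of i c] b[of i c] b[of "Suc i" c] by simp
  qed simp
  then show ?thesis using b assms by blast
qed

text \<open>Separates the geometry from the protocols. A triple \<open>(u, v, l)\<close> stands for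
  comparing \<open>a + l * b\<close> at \<open>u\<close> and \<open>v\<close>. Quantifying over all
  integer vectors and dimensions lets one list \<open>T\<close> serve both for points of a sphere
  and, with \<open>b = 0\<close>, for plain bit strings.\<close>

definition rigid :: "'v set \<Rightarrow> ('v \<times> 'v \<times> nat) list \<Rightarrow> 'v set \<Rightarrow> bool" where
  "rigid V T S \<longleftrightarrow> (\<forall>(a :: 'v \<Rightarrow> nat \<Rightarrow> int) b d R.
     (\<forall>v\<in>V. (\<Sum>c<d. (b v c)\<^sup>2) = R) \<longrightarrow>
     (\<forall>(u, v, l)\<in>set T. \<forall>c<d. a u c + int l * b u c = a v c + int l * b v c) \<longrightarrow>
     (\<forall>u\<in>S. \<forall>v\<in>S. \<forall>c<d. a u c = a v c \<and> b u c = b v c))"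

text \<open>Both ends of the ear lie in \<open>S\<close>, where the comparisons in \<open>T\<close>
  already force agreement; this is the hypothesis on the ends in \<open>ear_rigid\<close>. The
  labels restart at 0 on every ear.\<close>

lemma rigid_ear:
  assumes "rigid V T S" "S \<subseteq> V" "w 0 \<in> S" "w (Suc r) \<in> S" "\<And>i. 1 \<le> i \<Longrightarrow> i \<le> r \<Longrightarrow> w i \<in> V"
  shows "rigid V (T @ map (\<lambda>i. (w i, w (Suc i), i)) [0..<Suc r]) (S \<union> w ` {1..r})"
  unfolding rigid_def
proof (intro allI impI)
  fix a b :: "'a \<Rightarrow> nat \<Rightarrow> int" and d R
  assume norm: "\<forall>v\<in>V. (\<Sum>c<d. (b v c)\<^sup>2) = R"
    and agree: "\<forall>(u, v, l)\<in>set (T @ map (\<lambda>i. (w i, w (Suc i), i)) [0..<Suc r]).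
      \<forall>c<d. a u c + int l * b u c = a v c + int l * b v c"
  have S: "a u c = a v c \<and> b u c = b v c" if "u \<in> S" "v \<in> S" "c < d" for u v c
  proof -
    have "\<forall>(u, v, l)\<in>set T. \<forall>c<d. a u c + int l * b u c = a v c + int l * b v c"
      using agree by simp
    then show ?thesis
      using assms(1)[unfolded rigid_def, THEN spec[of _ a], THEN spec[of _ b], THEN spec[of _ d],
          THEN spec[of _ R]] norm that by blast
  qed
  have V: "w i \<in> V" if "i \<le> Suc r" for i
    using assms(2-5) that by (cases "i = 0 \<or> i = Suc r") auto
  have ear: "a (w i) c = a (w 0) c \<and> b (w i) c = b (w 0) c" if "i \<le> r" "c < d" for i c
  proof (rule ear_rigid[where r = r and d = d and R = R and a = "\<lambda>i. a (w i)" and b = "\<lambda>i. b (w i)"])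
    fix j k assume "j \<le> r" "k < d"
    moreover from this have "(w j, w (Suc j), j) \<in> set (T @ map (\<lambda>i. (w i, w (Suc i), i)) [0..<Suc r])"
      by (simp del: upt_Suc)
    ultimately show "a (w j) k + int j * b (w j) k = a (w (Suc j)) k + int j * b (w (Suc j)) k"
      using bspec[OF agree] by fast
  next
    show "(\<Sum>c<d. (b (w j) c)\<^sup>2) = R" if "j \<le> Suc r" for j using norm V that by blast
  next
    show "a (w (Suc r)) c = a (w 0) c \<and> b (w (Suc r)) c = b (w 0) c" if "c < d" for c
      using S[OF assms(4,3) that] .
  next
    show "i \<le> Suc r" "c < d" using that by auto
  qed
  have "a u c = a (w 0) c \<and> b u c = b (w 0) c" if "u \<in> S \<union> w ` {1..r}" "c < d" for u c
    using that(1)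
  proof
    assume "u \<in> S"
    then show ?thesis using S[OF _ assms(3) that(2)] by blast
  next
    assume "u \<in> w ` {1..r}"
    then obtain i where "i \<le> r" "u = w i" by auto
    then show ?thesis using ear[OF _ that(2)] by blast
  qed
  then show "\<forall>u\<in>S \<union> w ` {1..r}. \<forall>v\<in>S \<union> w ` {1..r}. \<forall>c<d. a u c = a v c \<and> b u c = b v c"
    by metis
qed

text \<open>The invariant charges each comparison to an edge of \<open>M\<close> inside
  \<open>S\<close>. Every edge of a new ear touches an inner vertex, so it did not lie inside the
  old \<open>S\<close> and is charged for the first time. The induction stops as soon as all
  vertices are covered; leftover edges only add slack.\<close>

lemma rigid_extend:
  assumes "finite V" "two_edge_connected V M" "\<And>e. e \<in># M \<Longrightarrow> e \<subseteq> V"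
    and "S \<subseteq> V" "S \<noteq> {}" "rigid V T S" "length T \<le> size {#e \<in># M. e \<subseteq> S#}"
    and "\<And>u v l. (u, v, l) \<in> set T \<Longrightarrow> {u, v} \<in># M"
  shows "\<exists>T. rigid V T V \<and> length T \<le> size M \<and> (\<forall>(u, v, l)\<in>set T. {u, v} \<in># M)"
  using assms(4-)
proof (induction "card (V - S)" arbitrary: S T rule: less_induct)
  case less
  show ?case
  proof (cases "S = V")
    case True
    have "size {#e \<in># M. e \<subseteq> S#} \<le> size M" by (simp add: size_mset_mono)
    then have "length T \<le> size M" using less.prems(4) by linarith
    with True less.prems show ?thesis by (intro exI[of _ T]) auto
  next
    case False
    obtain w r where w: "1 \<le> r" "w 0 \<in> S" "w (Suc r) \<in> S"
      "\<And>i. 1 \<le> i \<Longrightarrow> i \<le> r \<Longrightarrow> w i \<in> V - S"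
      "mset (map (\<lambda>i. {w i, w (Suc i)}) [0..<Suc r]) \<subseteq># M"
      by (rule two_edge_connected_ear[OF assms(2,3) less.prems(1,2) False]) blast+
    let ?S = "S \<union> w ` {1..r}" and ?T = "T @ map (\<lambda>i. (w i, w (Suc i), i)) [0..<Suc r]"
    let ?es = "map (\<lambda>i. {w i, w (Suc i)}) [0..<Suc r]"
    have wS: "w i \<in> ?S" if "i \<le> Suc r" for i
      using w(2,3) that by (cases "i = 0 \<or> i = Suc r") auto
    have fresh: "\<not> {w i, w (Suc i)} \<subseteq> S" if "i < Suc r" for i
      using w(1) w(4)[of i] w(4)[of "Suc i"] that by (cases "i = 0") auto
    have "{#e \<in># M. e \<subseteq> S#} + mset ?es \<subseteq># {#e \<in># M. e \<subseteq> ?S#}"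
    proof -
      have "mset ?es = {#e \<in># mset ?es. e \<subseteq> ?S \<and> \<not> e \<subseteq> S#}"
      proof -
        have "\<forall>e\<in>set ?es. e \<subseteq> ?S \<and> \<not> e \<subseteq> S"
        proof
          fix e assume "e \<in> set ?es"
          then obtain i where "i < Suc r" "e = {w i, w (Suc i)}"
            by (auto simp only: set_map set_upt atLeastLessThan_iff)
          then show "e \<subseteq> ?S \<and> \<not> e \<subseteq> S" using wS[of i] wS[of "Suc i"] fresh[of i] by simp
        qed
        then have "filter (\<lambda>e. e \<subseteq> ?S \<and> \<not> e \<subseteq> S) ?es = ?es" by (intro filter_True)
        then show ?thesis by (simp only: mset_filter[symmetric])
      qed
      also have "\<dots> \<subseteq># {#e \<in># M. e \<subseteq> ?S \<and> \<not> e \<subseteq> S#}"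
        using w(5) by (rule multiset_filter_mono)
      finally have "{#e \<in># M. e \<subseteq> S#} + mset ?es
          \<subseteq># {#e \<in># M. e \<subseteq> S#} + {#e \<in># M. e \<subseteq> ?S \<and> \<not> e \<subseteq> S#}"
        by (rule subset_mset.add_left_mono)
      also have "{#e \<in># M. e \<subseteq> S#} + {#e \<in># M. e \<subseteq> ?S \<and> \<not> e \<subseteq> S#} = {#e \<in># M. e \<subseteq> ?S#}"
        by (rule multiset_eqI) (simp, blast)
      finally show ?thesis .
    qed
    then have "size ({#e \<in># M. e \<subseteq> S#} + mset ?es) \<le> size {#e \<in># M. e \<subseteq> ?S#}"
      by (rule size_mset_mono)
    then have len: "length ?T \<le> size {#e \<in># M. e \<subseteq> ?S#}" using less.prems(4) by simp
    have edges: "{u, v} \<in># M" if "(u, v, l) \<in> set ?T" for u v l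
    proof (cases "(u, v, l) \<in> set T")
      case False
      then have "{u, v} \<in># mset ?es" using that by (auto simp del: upt_Suc)
      then show ?thesis using mset_subset_eqD[OF w(5)] by blast
    qed (use less.prems(5) in blast)
    have "w 1 \<in> V - S" "w 1 \<in> ?S" using w(1,4) by auto
    then have "V - ?S \<subset> V - S" by blast
    then have "card (V - ?S) < card (V - S)" using assms(1) by (intro psubset_card_mono) auto
    moreover have "rigid V ?T ?S"
      using less.prems(3,1) w(2-4) by (intro rigid_ear) auto
    moreover have "?S \<subseteq> V" using less.prems(1) w(4) by auto
    ultimately show ?thesis
      using less.hyps[of ?S ?T] len edges less.prems(2) by blast
  qed
qed

lemma rigid_exists:
  assumes "finite V" "two_edge_connected V M" "\<And>e. e \<in># M \<Longrightarrow> e \<subseteq> V"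
  obtains T where "rigid V T V" "length T \<le> size M" "\<And>u v l. (u, v, l) \<in> set T \<Longrightarrow> {u, v} \<in># M"
proof -
  obtain v where "v \<in> V"
    using assms(2) unfolding two_edge_connected_def graph_connected_def by blast
  then have "\<exists>T. rigid V T V \<and> length T \<le> size M \<and> (\<forall>(u, v, l)\<in>set T. {u, v} \<in># M)"
    using rigid_extend[OF assms, of "{v}" "[]"] by (auto simp: rigid_def)
  then show thesis using that by blast
qed

lemma c2_attained:
  assumes "simple_graph V E" "graph_connected V E"
  obtains M where "size M = c2 V E" "set_mset M \<subseteq> E" "two_edge_connected V M"
proof -
  have "finite E"
    using assms(1) unfolding simple_graph_def by (meson finite_Pow_iff finite_subset PowI subsetI)
  \<comment> \<open>Doubling every edge gives a witness for the minimum: deleting one copy leaves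
    the underlying edge set unchanged.\<close>
  define M where "M = mset_set E + mset_set E"
  have "set_mset (M - {#e#}) = E" if "e \<in> E" for e
    using that \<open>finite E\<close> unfolding M_def by (auto dest: in_diffD simp flip: count_greater_zero_iff)
  then have "two_edge_connected V M"
    using assms(2) \<open>finite E\<close> unfolding two_edge_connected_def by (auto simp: M_def)
  moreover have "count M e \<le> 2" for e
    unfolding M_def by (cases "e \<in> E") (auto simp: \<open>finite E\<close>)
  moreover have "set_mset M \<subseteq> E" using \<open>finite E\<close> by (auto simp: M_def)
  ultimately have "\<exists>k M. size M = k \<and> set_mset M \<subseteq> E \<and> (\<forall>e. count M e \<le> 2) \<and>
     two_edge_connected V M" by blast
  from LeastI_ex[OF this] show thesis using that unfolding c2_def by blast
qed

section \<open>Correct protocols and their cost\<close>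

definition correct_run ::
    "'v set \<Rightarrow> 'v set set \<Rightarrow> 'v protocol \<Rightarrow> ('v \<Rightarrow> bool list) \<Rightarrow> ('v \<Rightarrow> 'v event list) \<Rightarrow> bool" where
  "correct_run V E P x h \<longleftrightarrow> (step E P x)\<^sup>*\<^sup>* (\<lambda>_. []) h \<and>
     (\<forall>v\<in>V. P v (x v) (h v) = Output (\<forall>u\<in>V. \<forall>w\<in>V. x u = x w)) \<and>
     (\<forall>u\<in>V. \<forall>v\<in>V. received_from u (h v) = sent_to v (h u))"

definition solvable_within :: "nat \<Rightarrow> 'v set \<Rightarrow> 'v set set \<Rightarrow> nat \<Rightarrow> bool" where
  "solvable_within n V E c \<longleftrightarrow>
     (\<exists>P. \<forall>x\<in>inputs V n. \<exists>h. correct_run V E P x h \<and> bits_transmitted V h \<le> c)"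

text \<open>Complete runs are unique, so the bits of one correct run bound the cost of all. From
  here on it suffices to exhibit a single convenient order of execution.\<close>

lemma solvable_within_iff:
  assumes "simple_graph V E"
  shows "solvable_within n V E c \<longleftrightarrow> (\<exists>P. solves_equality V E n P \<and> cost_at_most V E n P c)"
proof
  assume "solvable_within n V E c"
  then obtain P where P: "\<forall>x\<in>inputs V n. \<exists>h. correct_run V E P x h \<and> bits_transmitted V h \<le> c"
    unfolding solvable_within_def by blast
  have "solves_equality V E n P"
    using P unfolding solves_equality_def complete_run_def correct_run_def by blast
  moreover have "cost_at_most V E n P c"
    unfolding cost_at_most_def
  proof (intro ballI allI impI)
    fix x h assume "x \<in> inputs V n" and h: "complete_run V E P x h"
    then obtain h' where h': "correct_run V E P x h'" "bits_transmitted V h' \<le> c" using P by blast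
    then have "complete_run V E P x h'" unfolding complete_run_def correct_run_def by blast
    then show "bits_transmitted V h \<le> c" using complete_run_unique[OF assms h] h' by blast
  qed
  ultimately show "\<exists>P. solves_equality V E n P \<and> cost_at_most V E n P c" by blast
next
  assume "\<exists>P. solves_equality V E n P \<and> cost_at_most V E n P c"
  then obtain P where P: "solves_equality V E n P" "cost_at_most V E n P c" by blast
  have "\<exists>h. correct_run V E P x h \<and> bits_transmitted V h \<le> c" if x: "x \<in> inputs V n" for x
  proof -
    obtain h where h: "complete_run V E P x h"
        "\<forall>v\<in>V. P v (x v) (h v) = Output (\<forall>u\<in>V. \<forall>w\<in>V. x u = x w)"
        "\<forall>u\<in>V. \<forall>v\<in>V. received_from u (h v) = sent_to v (h u)"
      using bspec[OF P(1)[unfolded solves_equality_def] x] by (elim exE conjE)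
    have "(step E P x)\<^sup>*\<^sup>* (\<lambda>_. []) h" using h(1) unfolding complete_run_def by (rule conjunct1)
    with h(2,3) have "correct_run V E P x h" unfolding correct_run_def by (intro conjI)
    then show ?thesis using P(2) h(1) x unfolding cost_at_most_def by blast
  qed
  then show "solvable_within n V E c" unfolding solvable_within_def by blast
qed

lemma equality_cost_le:
  "simple_graph V E \<Longrightarrow> solvable_within n V E c \<Longrightarrow> equality_cost n V E \<le> c"
  unfolding equality_cost_def solvable_within_iff by (rule Least_le)

lemma solvable_within_equality_cost:
  "simple_graph V E \<Longrightarrow> solvable_within n V E c \<Longrightarrow> solvable_within n V E (equality_cost n V E)"
  unfolding equality_cost_def solvable_within_iff by (rule LeastI_ex) blast

section \<open>Sequential composition\<close>

lemma sent_to_append: "sent_to v (g @ h) = sent_to v g @ sent_to v h"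
  by (simp add: sent_to_def)

lemma received_from_append: "received_from v (g @ h) = received_from v g @ received_from v h"
  by (simp add: received_from_def)

definition finished :: "'v protocol \<Rightarrow> 'v \<Rightarrow> bool list \<Rightarrow> 'v event list \<Rightarrow> bool" where
  "finished P v x h \<longleftrightarrow> (\<exists>b. P v x h = Output b)"

text \<open>A player has no memory besides its history, so the end of the first stage is recovered
  as the shortest prefix on which \<open>P\<close> outputs. The second stage sees only the rest of
  the history, and the two answers are conjoined.\<close>

definition seq_protocol :: "nat \<Rightarrow> 'v protocol \<Rightarrow> 'v protocol \<Rightarrow> 'v protocol" where
  "seq_protocol n P Q v x h =
     (if \<exists>k. finished P v (take n x) (take k h) then
        let k = LEAST k. finished P v (take n x) (take k h) in
        case Q v (drop n x) (drop k h) of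
          Output b \<Rightarrow> Output (b \<and> P v (take n x) (take k h) = Output True)
        | a \<Rightarrow> a
      else P v (take n x) h)"

lemma seq_protocol_first:
  assumes "\<And>k. k \<le> length h \<Longrightarrow> \<not> finished P v (take n x) (take k h)"
  shows "seq_protocol n P Q v x h = P v (take n x) h"
proof -
  have "\<not> finished P v (take n x) (take k h)" for k
    using assms[of k] assms[of "length h"] by (cases "k \<le> length h") auto
  then show ?thesis unfolding seq_protocol_def by auto
qed

lemma seq_protocol_second:
  assumes "\<And>k. k < length h \<Longrightarrow> \<not> finished P v (take n x) (take k h)"
    and "P v (take n x) h = Output c"
  shows "seq_protocol n P Q v x (h @ g) =
    (case Q v (drop n x) g of Output b \<Rightarrow> Output (b \<and> c) | a \<Rightarrow> a)"
proof -
  have fin: "finished P v (take n x) (take (length h) (h @ g))"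
    using assms(2) by (simp add: finished_def)
  then have ex: "\<exists>k. finished P v (take n x) (take k (h @ g))" by (rule exI)
  have least: "(LEAST k. finished P v (take n x) (take k (h @ g))) = length h"
  proof (rule Least_equality)
    show "finished P v (take n x) (take (length h) (h @ g))" by (rule fin)
  next
    fix k assume "finished P v (take n x) (take k (h @ g))"
    then show "length h \<le> k" using assms(1)[of k] by (cases "k < length h") auto
  qed
  show ?thesis
    unfolding seq_protocol_def if_P[OF ex] Let_def least using assms(2)
    by (auto split: action.split)
qed

text \<open>Players act only while their protocol has no output. Hence no proper prefix of a history
  reached in a run is finished, and \<open>seq_protocol\<close> cuts exactly where the first stage
  ended.\<close>

lemma unfinished_before:
  assumes "(step E P x)\<^sup>*\<^sup>* (\<lambda>_. []) h" "k < length (h v)"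
  shows "\<not> finished P v (x v) (take k (h v))"
  using assms
proof (induction arbitrary: k rule: rtranclp_induct)
  case (step h h')
  from step.hyps(2) obtain u e where h': "h' = h(u := h u @ [e])" "\<not> finished P u (x u) (h u)"
    unfolding step_acting finished_def by fastforce
  show ?case
  proof (cases "v = u \<and> k = length (h v)")
    case True
    then show ?thesis using h' by simp
  next
    case False
    then have "k < length (h v)" "take k (h' v) = take k (h v)"
      using step.prems h' by (auto split: if_splits)
    then show ?thesis using step.IH by simp
  qed
qed simp

lemma seq_protocol_steps_first:
  assumes "(step E P (\<lambda>v. take n (x v)))\<^sup>*\<^sup>* (\<lambda>_. []) h"
  shows "(step E (seq_protocol n P Q) x)\<^sup>*\<^sup>* (\<lambda>_. []) h"
  using assms
proof (induction rule: rtranclp_induct)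
  case (step h h')
  have eq: "seq_protocol n P Q v (x v) (h v) = P v (take n (x v)) (h v)"
    if "\<not> finished P v (take n (x v)) (h v)" for v
  proof (rule seq_protocol_first)
    fix k assume "k \<le> length (h v)"
    then show "\<not> finished P v (take n (x v)) (take k (h v))"
      using unfinished_before[OF step.hyps(1), of k v] that by (cases "k = length (h v)") auto
  qed
  from step.hyps(2) have "step E (seq_protocol n P Q) x h h'"
  proof cases
    case (send u v b)
    then have "seq_protocol n P Q u (x u) (h u) = Send v b"
      using eq[of u] by (simp add: finished_def)
    then show ?thesis using step.send send by metis
  next
    case (receive v u b bs)
    then have "seq_protocol n P Q v (x v) (h v) = Receive u"
      using eq[of v] by (simp add: finished_def)
    then show ?thesis using step.receive receive by metis
  qed
  then show ?case using step.IH by simp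
qed simp

text \<open>The channels have to be empty after the first stage; otherwise its leftover bits would
  be delivered before those of the second.\<close>

lemma seq_protocol_steps_second:
  assumes graph: "simple_graph V E"
    and run: "(step E P (\<lambda>v. take n (x v)))\<^sup>*\<^sup>* (\<lambda>_. []) h"
    and fin: "\<And>v. v \<in> V \<Longrightarrow> P v (take n (x v)) (h v) = Output c"
    and empty: "\<And>u v. u \<in> V \<Longrightarrow> v \<in> V \<Longrightarrow> received_from u (h v) = sent_to v (h u)"
    and run2: "(step E Q (\<lambda>v. drop n (x v)))\<^sup>*\<^sup>* (\<lambda>_. []) g"
  shows "(step E (seq_protocol n P Q) x)\<^sup>*\<^sup>* h (\<lambda>v. h v @ g v)"
  using run2
proof (induction rule: rtranclp_induct)
  case (step g g')
  have eq: "seq_protocol n P Q v (x v) (h v @ g v) =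
    (case Q v (drop n (x v)) (g v) of Output b \<Rightarrow> Output (b \<and> c) | a \<Rightarrow> a)" if "v \<in> V" for v
    by (rule seq_protocol_second[OF unfinished_before[OF run] fin[OF that]])
  have V: "u \<in> V \<and> v \<in> V" if "{u, v} \<in> E" for u v
    using graph that unfolding simple_graph_def by blast
  from step.hyps(2) have "step E (seq_protocol n P Q) x (\<lambda>v. h v @ g v) (\<lambda>v. h v @ g' v)"
  proof cases
    case (send u v b)
    then have "seq_protocol n P Q u (x u) (h u @ g u) = Send v b"
      using eq[of u] V by simp
    from step.send[of "seq_protocol n P Q" u x "\<lambda>v. h v @ g v", OF this send(3)]
    show ?thesis using send(1) by (simp add: fun_upd_def if_distrib cong: if_cong)
  next
    case (receive v u b bs)
    then have "seq_protocol n P Q v (x v) (h v @ g v) = Receive u"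
      using eq[of v] V by simp
    from step.receive[of "seq_protocol n P Q" v x "\<lambda>v. h v @ g v" u E b bs, OF this receive(3)]
    show ?thesis using receive(1,4) empty[of u v] V[OF receive(3)]
      by (simp add: fun_upd_def if_distrib sent_to_append received_from_append cong: if_cong)
  qed
  then show ?case using step.IH by simp
qed simp

lemma take_drop_eq_iff: "x = y \<longleftrightarrow> take n x = take n y \<and> drop n x = drop n y"
  by (metis append_take_drop_id)

text \<open>Subadditivity: \<open>P\<close> treats the first \<open>m\<close> bits and
  \<open>Q\<close> the remaining \<open>n\<close>, and strings are equal iff both parts are.\<close>

lemma solvable_within_add:
  assumes graph: "simple_graph V E" and "solvable_within m V E c" "solvable_within n V E d"
  shows "solvable_within (m + n) V E (c + d)"
proof -
  obtain P where P: "\<forall>x\<in>inputs V m. \<exists>h. correct_run V E P x h \<and> bits_transmitted V h \<le> c"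
    using assms(2) unfolding solvable_within_def by blast
  obtain Q where Q: "\<forall>x\<in>inputs V n. \<exists>h. correct_run V E Q x h \<and> bits_transmitted V h \<le> d"
    using assms(3) unfolding solvable_within_def by blast
  have "\<exists>h. correct_run V E (seq_protocol m P Q) x h \<and> bits_transmitted V h \<le> c + d"
    if x: "x \<in> inputs V (m + n)" for x
  proof -
    have "(\<lambda>v. take m (x v)) \<in> inputs V m" "(\<lambda>v. drop m (x v)) \<in> inputs V n"
      using x by (auto simp: inputs_def)
    with P Q obtain h g where h: "correct_run V E P (\<lambda>v. take m (x v)) h" "bits_transmitted V h \<le> c"
      and g: "correct_run V E Q (\<lambda>v. drop m (x v)) g" "bits_transmitted V g \<le> d" by meson
    let ?h = "\<lambda>v. h v @ g v"
    note h' = h(1)[unfolded correct_run_def] and g' = g(1)[unfolded correct_run_def]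
    let ?c = "\<forall>u\<in>V. \<forall>w\<in>V. take m (x u) = take m (x w)"
    have steps: "(step E (seq_protocol m P Q) x)\<^sup>*\<^sup>* h ?h"
      by (rule seq_protocol_steps_second[OF graph, where c = ?c]) (use h' g' in auto)
    have "(step E (seq_protocol m P Q) x)\<^sup>*\<^sup>* (\<lambda>_. []) ?h"
      using seq_protocol_steps_first[of E P m x h Q] h' steps by auto
    moreover have "seq_protocol m P Q v (x v) (?h v) = Output (\<forall>u\<in>V. \<forall>w\<in>V. x u = x w)"
      if "v \<in> V" for v
    proof -
      have "P v (take m (x v)) (h v) = Output ?c" using h' that by blast
      then have "seq_protocol m P Q v (x v) (?h v) =
          (case Q v (drop m (x v)) (g v) of Output b \<Rightarrow> Output (b \<and> ?c) | a \<Rightarrow> a)"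
        using unfinished_before[of E P "\<lambda>v. take m (x v)" h] h'
        by (intro seq_protocol_second) auto
      also have "\<dots> = Output ((\<forall>u\<in>V. \<forall>w\<in>V. drop m (x u) = drop m (x w)) \<and> ?c)"
        using g' that by simp
      also have "((\<forall>u\<in>V. \<forall>w\<in>V. drop m (x u) = drop m (x w)) \<and> ?c) = (\<forall>u\<in>V. \<forall>w\<in>V. x u = x w)"
        using take_drop_eq_iff by blast
      finally show ?thesis .
    qed
    moreover have "received_from u (?h v) = sent_to v (?h u)" if "u \<in> V" "v \<in> V" for u v
      using h' g' that by (simp add: sent_to_append received_from_append)
    ultimately have "correct_run V E (seq_protocol m P Q) x ?h"
      unfolding correct_run_def by blast
    moreover have "bits_transmitted V ?h \<le> c + d"
      using h(2) g(2) by (simp add: bits_transmitted_def sum.distrib)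
    ultimately show ?thesis by blast
  qed
  then show ?thesis unfolding solvable_within_def by blast
qed

section \<open>Protocols with a fixed schedule\<close>

text \<open>In the slot \<open>(u, v, f, g)\<close> player \<open>u\<close> sends one bit to \<open>v\<close>. The receiver expects the value of
  \<open>f\<close> at its own input. The flag \<open>g\<close> marks slots that also carry an alarm: \<open>u\<close> sends
  \<open>False\<close> if it has ever received an unexpected bit.\<close>

type_synonym 'v slot = "'v \<times> 'v \<times> (bool list \<Rightarrow> bool) \<times> bool"

definition own_slots :: "'v slot list \<Rightarrow> 'v \<Rightarrow> 'v slot list" where
  "own_slots ss p = filter (\<lambda>(u, v, _). u = p \<or> v = p) ss"

fun expected :: "bool list \<Rightarrow> 'v event \<Rightarrow> 'v slot \<Rightarrow> bool" where
  "expected x (Received w b) (u, v, f, g) = (b = f x)"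
| "expected x (Sent w b) s = True"

text \<open>The \<open>k\<close>-th event of a player belongs to its \<open>k\<close>-th own slot.
  As \<open>zip\<close> truncates, the same formula also judges incomplete histories, which is what
  a player has when it must decide whether to raise an alarm.\<close>

definition content :: "'v slot list \<Rightarrow> 'v \<Rightarrow> bool list \<Rightarrow> 'v event list \<Rightarrow> bool" where
  "content ss p x h \<longleftrightarrow> (\<forall>(e, s)\<in>set (zip h (own_slots ss p)). expected x e s)"

definition schedule :: "'v slot list \<Rightarrow> 'v protocol" where
  "schedule ss p x h =
     (if length h < length (own_slots ss p) then
        case own_slots ss p ! length h of (u, v, f, g) \<Rightarrow>
          if u = p then Send v (f x \<and> (g \<longrightarrow> content ss p x h)) else Receive u
      else Output (content ss p x h))"

definition transmit ::
    "'v slot list \<Rightarrow> ('v \<Rightarrow> bool list) \<Rightarrow> 'v slot \<Rightarrow> ('v \<Rightarrow> 'v event list) \<Rightarrow> ('v \<Rightarrow> 'v event list)" where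
  "transmit ss x = (\<lambda>(u, v, f, g) h.
     let b = f (x u) \<and> (g \<longrightarrow> content ss u (x u) (h u))
     in h(u := h u @ [Sent v b], v := h v @ [Received u b]))"

text \<open>The reference execution, in which every bit is received before the next slot begins. The
  full schedule \<open>ss\<close> is kept apart from the part \<open>ts\<close> already carried out
  because players judge their histories against \<open>ss\<close>.\<close>

definition trace ::
    "'v slot list \<Rightarrow> ('v \<Rightarrow> bool list) \<Rightarrow> 'v slot list \<Rightarrow> ('v \<Rightarrow> 'v event list)" where
  "trace ss x ts = fold (transmit ss x) ts (\<lambda>_. [])"

lemma trace_Nil [simp]: "trace ss x [] = (\<lambda>_. [])"
  by (simp add: trace_def)

lemma trace_snoc: "trace ss x (ts @ [s]) = transmit ss x s (trace ss x ts)"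
  by (simp add: trace_def)

lemma own_slots_append: "own_slots (ss @ ts) p = own_slots ss p @ own_slots ts p"
  by (simp add: own_slots_def)

lemma own_slots_Cons:
  "own_slots ((u, v, f, g) # ts) p = (if u = p \<or> v = p then [(u, v, f, g)] else []) @ own_slots ts p"
  by (simp add: own_slots_def)

lemma own_slots_Nil [simp]: "own_slots [] p = []"
  by (simp add: own_slots_def)

definition valid_slots :: "'v set set \<Rightarrow> 'v slot list \<Rightarrow> bool" where
  "valid_slots E ss \<longleftrightarrow> (\<forall>(u, v, _)\<in>set ss. {u, v} \<in> E \<and> u \<noteq> v)"

lemma length_trace:
  assumes "valid_slots E ss" "set ts \<subseteq> set ss"
  shows "length (trace ss x ts p) = length (own_slots ts p)"
  using assms(2)
proof (induction ts rule: rev_induct)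
  case (snoc s ts)
  obtain u v f g where s: "s = (u, v, f, g)" by (cases s)
  then have "u \<noteq> v" using assms(1) snoc.prems unfolding valid_slots_def by auto
  then show ?case
    using snoc by (auto simp: trace_snoc s transmit_def Let_def own_slots_append own_slots_Cons)
qed simp

lemma received_trace:
  assumes "valid_slots E ss" "set ts \<subseteq> set ss"
  shows "received_from p (trace ss x ts q) = sent_to q (trace ss x ts p)"
  using assms(2)
proof (induction ts rule: rev_induct)
  case (snoc s ts)
  obtain u v f g where s: "s = (u, v, f, g)" by (cases s)
  then have "u \<noteq> v" using assms(1) snoc.prems unfolding valid_slots_def by auto
  then show ?case
    using snoc by (auto simp: trace_snoc s transmit_def Let_def received_from_snoc sent_to_snoc)
qed (simp add: received_from_def sent_to_def)

lemma bits_trace: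
  assumes "valid_slots E ss" "set ts \<subseteq> set ss" "finite V" "\<And>e. e \<in> E \<Longrightarrow> e \<subseteq> V"
  shows "bits_transmitted V (trace ss x ts) = length ts"
  using assms(2)
proof (induction ts rule: rev_induct)
  case (snoc s ts)
  obtain u v f g where s: "s = (u, v, f, g)" by (cases s)
  then have "u \<noteq> v" "{u, v} \<in> E" using assms(1) snoc.prems unfolding valid_slots_def by auto
  then have "u \<in> V" using assms(4) by blast
  have "length (filter is_Sent (trace ss x (ts @ [s]) p)) =
      length (filter is_Sent (trace ss x ts p)) + (if p = u then 1 else 0)" for p
    using \<open>u \<noteq> v\<close> by (auto simp: trace_snoc s transmit_def Let_def)
  then show ?case
    using snoc \<open>u \<in> V\<close> assms(3) by (simp add: bits_transmitted_def sum.distrib)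
qed (simp add: bits_transmitted_def)

text \<open>The recursion behind all correctness arguments: a slot can change only the state of its
  receiver, and only from content to not content.\<close>

lemma content_trace_snoc:
  assumes valid: "valid_slots E ss" and ss: "ss = ts @ (u, v, f, g) # rs"
  shows "content ss p y (trace ss x (ts @ [(u, v, f, g)]) p) \<longleftrightarrow>
    content ss p y (trace ss x ts p) \<and>
    (p = v \<longrightarrow> (f (x u) \<and> (g \<longrightarrow> content ss u (x u) (trace ss x ts u))) = f y)"
proof -
  have uv: "u \<noteq> v" using valid unfolding ss valid_slots_def by auto
  have len: "length (trace ss x ts q) = length (own_slots ts q)" for q
    using valid by (rule length_trace) (auto simp: ss)
  have own: "own_slots ss p =
      own_slots ts p @ (if u = p \<or> v = p then [(u, v, f, g)] else []) @ own_slots rs p"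
    by (simp add: ss own_slots_append own_slots_Cons)
  have same: "content ss p y (trace ss x ts p) \<longleftrightarrow>
      (\<forall>(e, s)\<in>set (zip (trace ss x ts p) (own_slots ts p)). expected y e s)"
    by (simp add: content_def own zip_append2 len)
  show ?thesis
  proof (cases "u = p \<or> v = p")
    case True
    define b where "b = (f (x u) \<and> (g \<longrightarrow> content ss u (x u) (trace ss x ts u)))"
    define e where "e = (if p = v then Received u b else Sent v b)"
    have "trace ss x (ts @ [(u, v, f, g)]) p = trace ss x ts p @ [e]"
      using uv True by (auto simp: trace_snoc transmit_def Let_def b_def e_def)
    then have "content ss p y (trace ss x (ts @ [(u, v, f, g)]) p) \<longleftrightarrow>
        (\<forall>(e, s)\<in>set (zip (trace ss x ts p) (own_slots ts p)). expected y e s) \<and>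
        expected y e (u, v, f, g)"
      using True by (simp add: content_def[of ss p] own zip_append2 len conj_commute)
    also have "expected y e (u, v, f, g) \<longleftrightarrow> (p = v \<longrightarrow> b = f y)"
      using True by (auto simp: e_def)
    finally show ?thesis unfolding same b_def .
  next
    case False
    then have "p \<noteq> u" "p \<noteq> v" by auto
    then show ?thesis by (simp add: trace_snoc transmit_def Let_def)
  qed
qed

lemma schedule_current:
  assumes ss: "ss = ts @ (u, v, f, g) # rs" and p: "p = u \<or> p = v"
    and len: "length h = length (own_slots ts p)"
  shows "schedule ss p y h =
    (if u = p then Send v (f y \<and> (g \<longrightarrow> content ss p y h)) else Receive u)"
proof -
  have "own_slots ss p = own_slots ts p @ (u, v, f, g) # own_slots rs p"
    using p by (auto simp: ss own_slots_append own_slots_Cons)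
  then show ?thesis using len by (simp add: schedule_def nth_append)
qed

lemma schedule_steps:
  assumes valid: "valid_slots E ss" and "ss = ts @ rs"
  shows "(step E (schedule ss) x)\<^sup>*\<^sup>* (\<lambda>_. []) (trace ss x ts)"
  using assms(2)
proof (induction ts arbitrary: rs rule: rev_induct)
  case (snoc s ts)
  obtain u v f g where s: "s = (u, v, f, g)" by (cases s)
  have ss: "ss = ts @ (u, v, f, g) # rs" using snoc.prems s by simp
  have uv: "u \<noteq> v" "{u, v} \<in> E" using valid unfolding ss valid_slots_def by auto
  let ?h = "trace ss x ts"
  define b where "b = (f (x u) \<and> (g \<longrightarrow> content ss u (x u) (?h u)))"
  let ?h' = "?h(u := ?h u @ [Sent v b])"
  have len: "length (?h q) = length (own_slots ts q)" for q
    using valid by (rule length_trace) (auto simp: ss)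
  have channel: "received_from u (?h v) = sent_to v (?h u)"
    using valid by (rule received_trace) (auto simp: ss)
  have start: "(step E (schedule ss) x)\<^sup>*\<^sup>* (\<lambda>_. []) ?h" by (rule snoc.IH[of "s # rs"]) (simp add: snoc.prems)
  have sending: "step E (schedule ss) x ?h ?h'"
    by (rule step.send) (use uv schedule_current[OF ss, of u "?h u"] len b_def in auto)
  have receiving: "step E (schedule ss) x ?h' (?h'(v := ?h' v @ [Received u b]))"
  proof (rule step.receive)
    show "schedule ss v (x v) (?h' v) = Receive u"
      using uv schedule_current[OF ss, of v "?h v"] len by auto
    show "sent_to v (?h' u) = received_from u (?h' v) @ b # []"
      using uv channel by (simp add: sent_to_snoc)
  qed (rule uv)
  have "?h'(v := ?h' v @ [Received u b]) = trace ss x (ts @ [s])"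
    using uv by (simp add: trace_snoc s transmit_def b_def Let_def)
  moreover have "(step E (schedule ss) x)\<^sup>*\<^sup>* (\<lambda>_. []) ?h'"
    using start sending by (metis rtranclp.rtrancl_into_rtrancl)
  then have "(step E (schedule ss) x)\<^sup>*\<^sup>* (\<lambda>_. []) (?h'(v := ?h' v @ [Received u b]))"
    using receiving by (metis rtranclp.rtrancl_into_rtrancl)
  ultimately show ?case by (simp only:)
qed simp

text \<open>No false alarms: with equal inputs every test bit is the expected one, and nobody ever
  becomes discontent, so the alarm slots carry \<open>True\<close> as well.\<close>

lemma content_if_all_equal:
  assumes "valid_slots E ss" "\<And>e. e \<in> E \<Longrightarrow> e \<subseteq> V" "\<forall>u\<in>V. \<forall>w\<in>V. x u = x w"
    and "ss = ts @ rs" "p \<in> V"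
  shows "content ss p (x p) (trace ss x ts p)"
  using assms(4,5)
proof (induction ts arbitrary: rs p rule: rev_induct)
  case Nil
  then show ?case by (simp add: content_def)
next
  case (snoc s ts)
  obtain u v f g where s: "s = (u, v, f, g)" by (cases s)
  have ss: "ss = ts @ (u, v, f, g) # rs" using snoc.prems s by simp
  have "{u, v} \<in> E" using assms(1) unfolding ss valid_slots_def by auto
  then have uv: "u \<in> V" "v \<in> V" using assms(2) by auto
  then have "x u = x v" using assms(3) by blast
  moreover have "content ss q (x q) (trace ss x ts q)" if "q \<in> V" for q
    using snoc.IH[of "(u, v, f, g) # rs" q] that by (simp add: ss)
  ultimately show ?case
    unfolding s content_trace_snoc[OF assms(1) ss] using uv snoc.prems by metis
qed

text \<open>Discontent is never revoked, so players content at the end were content at each slot; a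
  test slot then carried the value the receiver expected.\<close>

lemma content_test_slots:
  assumes "valid_slots E ss" "ss = ts @ rs" "\<And>p. content ss p (x p) (trace ss x ts p)"
    and "(u, v, f, False) \<in> set ts"
  shows "f (x u) = f (x v)"
  using assms(2-4)
proof (induction ts arbitrary: rs rule: rev_induct)
  case (snoc s ts)
  obtain u' v' f' g where s: "s = (u', v', f', g)" by (cases s)
  have ss: "ss = ts @ (u', v', f', g) # rs" using snoc.prems s by simp
  have c: "content ss p (x p) (trace ss x ts p) \<and>
    (p = v' \<longrightarrow> (f' (x u') \<and> (g \<longrightarrow> content ss u' (x u') (trace ss x ts u'))) = f' (x p))" for p
    using snoc.prems(2)[of p] unfolding s content_trace_snoc[OF assms(1) ss] .
  show ?case
  proof (cases "(u, v, f, False) = s")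
    case True
    then show ?thesis using c[of v] s by auto
  next
    case False
    then show ?thesis using snoc.IH[of "s # rs"] snoc.prems c by auto
  qed
qed simp

section \<open>Propagation of alarms\<close>

definition spread :: "('v \<times> 'v) list \<Rightarrow> 'v set \<Rightarrow> 'v set" where
  "spread D = fold (\<lambda>(u, v) S. if u \<in> S then insert v S else S) D"

lemma spread_Nil [simp]: "spread [] S = S"
  by (simp add: spread_def)

lemma spread_append: "spread (C @ D) S = spread D (spread C S)"
  by (simp add: spread_def)

lemma spread_snoc:
  "spread (D @ [(u, v)]) S = (if u \<in> spread D S then insert v (spread D S) else spread D S)"
  by (simp add: spread_def)

lemma spread_increasing: "S \<subseteq> spread D S"
  by (induction D rule: rev_induct) (auto simp: spread_snoc)

lemma spread_mono: "S \<subseteq> T \<Longrightarrow> spread D S \<subseteq> spread D T"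
  by (induction D rule: rev_induct) (auto simp: spread_snoc split: if_splits)

text \<open>Discontent is contagious: in an alarm slot a discontent sender transmits
  \<open>False\<close> where the receiver expects \<open>True\<close>. Content senders do no harm,
  so the discontent players include everything \<open>spread\<close> reaches.\<close>

lemma alarm_spreads:
  assumes "valid_slots E ss" "ss = ts @ map (\<lambda>(u, v). (u, v, (\<lambda>_. True), True)) D @ rs"
  shows "spread D {p. \<not> content ss p (x p) (trace ss x ts p)} \<subseteq>
    {p. \<not> content ss p (x p) (trace ss x (ts @ map (\<lambda>(u, v). (u, v, (\<lambda>_. True), True)) D) p)}"
  using assms(2)
proof (induction D arbitrary: rs rule: rev_induct)
  case (snoc d D)
  obtain u v where d: "d = (u, v)" by (cases d)
  let ?ts = "ts @ map (\<lambda>(u, v). (u, v, (\<lambda>_. True), True)) D"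
  have ss: "ss = ?ts @ (u, v, (\<lambda>_. True), True) # rs" using snoc.prems d by simp
  have "spread D {p. \<not> content ss p (x p) (trace ss x ts p)} \<subseteq>
      {p. \<not> content ss p (x p) (trace ss x ?ts p)}"
    by (rule snoc.IH[of "(u, v, (\<lambda>_. True), True) # rs"]) (simp add: ss)
  then show ?case
    using content_trace_snoc[OF assms(1) ss, of _ _ x] by (auto simp: d spread_snoc)
qed simp

lemma spread_walk:
  assumes "(u, v) \<in> {(a, b). {a, b} \<in> E}\<^sup>*"
  obtains D where "\<And>a b. (a, b) \<in> set D \<Longrightarrow> {a, b} \<in> E" "v \<in> spread D {u}"
proof -
  from assms have "\<exists>D. (\<forall>(a, b)\<in>set D. {a, b} \<in> E) \<and> v \<in> spread D {u}"
  proof (induction rule: rtrancl_induct)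
    case base
    show ?case by (intro exI[of _ "[]"]) simp
  next
    case (step y z)
    then obtain D where "\<forall>(a, b)\<in>set D. {a, b} \<in> E" "y \<in> spread D {u}" by blast
    then show ?case using step.hyps by (intro exI[of _ "D @ [(y, z)]"]) (auto simp: spread_snoc)
  qed
  then show thesis using that by blast
qed

text \<open>One list has to work for every source, since it is unknown who will detect a difference.
  Walks for all ordered pairs are concatenated; this is wasteful, but the length depends on the
  graph only.\<close>

lemma broadcast_exists:
  assumes "finite V" "graph_connected V E"
  obtains D where "\<And>a b. (a, b) \<in> set D \<Longrightarrow> {a, b} \<in> E" "\<And>u. u \<in> V \<Longrightarrow> V \<subseteq> spread D {u}"
proof -
  have "\<exists>D. (\<forall>(a, b)\<in>set D. {a, b} \<in> E) \<and> (\<forall>(u, v)\<in>Q. v \<in> spread D {u})"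
    if "finite Q" "Q \<subseteq> V \<times> V" for Q
    using that
  proof (induction Q rule: finite_induct)
    case empty
    show ?case by (intro exI[of _ "[]"]) simp
  next
    case (insert q Q)
    obtain u v where q: "q = (u, v)" by (cases q)
    obtain C where C: "\<forall>(a, b)\<in>set C. {a, b} \<in> E" "\<forall>(u, v)\<in>Q. v \<in> spread C {u}"
      using insert by auto
    have "(u, v) \<in> {(a, b). {a, b} \<in> E}\<^sup>*"
      using assms(2) insert.prems q unfolding graph_connected_def by blast
    then obtain D where D: "\<And>a b. (a, b) \<in> set D \<Longrightarrow> {a, b} \<in> E" "v \<in> spread D {u}"
      by (rule spread_walk) blast
    have "v \<in> spread (C @ D) {u}"
      using D(2) spread_mono[OF spread_increasing[of "{u}" C], of D] by (auto simp: spread_append)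
    moreover have "v' \<in> spread (C @ D) {u'}" if "(u', v') \<in> Q" for u' v'
      using C(2) that spread_increasing[of "spread C {u'}" D] by (auto simp: spread_append)
    ultimately show ?case
      using C(1) D(1) q by (intro exI[of _ "C @ D"]) auto
  qed
  from this[of "V \<times> V"] assms(1) show thesis using that by (auto simp: subset_iff)
qed

text \<open>Reduces protocol design to a list of one-bit tests that together determine equality.
  Each test costs one bit, and the broadcast \<open>D\<close> is the only overhead.\<close>

lemma solvable_within_tests:
  fixes A :: "('v \<times> 'v \<times> (bool list \<Rightarrow> bool)) list"
  assumes graph: "simple_graph V E"
    and tests: "\<And>u v f. (u, v, f) \<in> set A \<Longrightarrow> {u, v} \<in> E"
    and determined: "\<And>x. x \<in> inputs V n \<Longrightarrow> (\<And>u v f. (u, v, f) \<in> set A \<Longrightarrow> f (x u) = f (x v)) \<Longrightarrow>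
      (\<forall>u\<in>V. \<forall>w\<in>V. x u = x w)"
    and D: "\<And>a b. (a, b) \<in> set D \<Longrightarrow> {a, b} \<in> E" "\<And>u. u \<in> V \<Longrightarrow> V \<subseteq> spread D {u}"
  shows "solvable_within n V E (length A + length D)"
proof -
  define ts where "ts = map (\<lambda>(u, v, f). (u, v, f, False)) A"
  define ss where "ss = ts @ map (\<lambda>(u, v). (u, v, (\<lambda>_. True), True)) D"
  have E: "e \<subseteq> V" "card e = 2" if "e \<in> E" for e using graph that unfolding simple_graph_def by auto
  have ne: "u \<noteq> v" if "{u, v} \<in> E" for u v using E(2)[OF that] by auto
  have valid: "valid_slots E ss"
    unfolding valid_slots_def
  proof clarify
    fix u v f g assume "(u, v, f, g) \<in> set ss"
    then have "{u, v} \<in> E" using tests D(1) by (auto simp: ss_def ts_def)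
    then show "{u, v} \<in> E \<and> u \<noteq> v" using ne by blast
  qed
  have "correct_run V E (schedule ss) x (trace ss x ss)" if x: "x \<in> inputs V n" for x
  proof -
    have "content ss p (x p) (trace ss x ss p) \<longleftrightarrow> (\<forall>u\<in>V. \<forall>w\<in>V. x u = x w)" if p: "p \<in> V" for p
    proof
      assume eq: "\<forall>u\<in>V. \<forall>w\<in>V. x u = x w"
      show "content ss p (x p) (trace ss x ss p)"
        by (rule content_if_all_equal[OF valid E(1) eq _ p, of _ "[]"]) simp_all
    next
      assume c: "content ss p (x p) (trace ss x ss p)"
      have all: "content ss q (x q) (trace ss x ts q)" for q
      proof (rule ccontr)
        assume q: "\<not> content ss q (x q) (trace ss x ts q)"
        show False
        proof (cases "q \<in> V")
          case True
          have "p \<in> spread D {q}" using D(2)[OF True] p by blast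
          also have "\<dots> \<subseteq> spread D {p. \<not> content ss p (x p) (trace ss x ts p)}"
            using q by (intro spread_mono) auto
          also have "\<dots> \<subseteq> {p. \<not> content ss p (x p) (trace ss x ss p)}"
            using alarm_spreads[OF valid, of ts D "[]" x] by (simp add: ss_def)
          finally show False using c by simp
        next
          case False
          \<comment> \<open>\<open>content_test_slots\<close> speaks of all \<open>p\<close>,
            including those outside \<open>V\<close>; these have an empty history and are trivially
            content.\<close>
          have "own_slots ts q = []"
            using False E(1) tests unfolding own_slots_def ts_def filter_empty_conv by fastforce
          then have "trace ss x ts q = []"
            using length_trace[OF valid, of ts x q] by (simp add: ss_def)
          then show False using q by (simp add: content_def)
        qed
      qed
      show "\<forall>u\<in>V. \<forall>w\<in>V. x u = x w"
      proof (rule determined[OF x])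
        fix u v f assume "(u, v, f) \<in> set A"
        then have "(u, v, f, False) \<in> set ts" by (force simp: ts_def)
        then show "f (x u) = f (x v)"
          by (rule content_test_slots[OF valid ss_def all])
      qed
    qed
    moreover have "schedule ss p (x p) (trace ss x ss p) = Output (content ss p (x p) (trace ss x ss p))"
      for p
      using length_trace[OF valid, of ss x p] by (simp add: schedule_def)
    moreover have "(step E (schedule ss) x)\<^sup>*\<^sup>* (\<lambda>_. []) (trace ss x ss)"
      by (rule schedule_steps[OF valid, of _ "[]"]) simp
    ultimately show ?thesis
      using received_trace[OF valid, of ss] unfolding correct_run_def by auto
  qed
  moreover have "bits_transmitted V (trace ss x ss) = length A + length D" for x
  proof -
    have "finite V" using graph unfolding simple_graph_def by simp
    then have "bits_transmitted V (trace ss x ss) = length ss"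
      using bits_trace[OF valid _ _ E(1)] by blast
    then show ?thesis by (simp add: ss_def ts_def)
  qed
  ultimately show ?thesis unfolding solvable_within_def by (metis order_refl)
qed

section \<open>Encoding inputs by points of a sphere\<close>

text \<open>There are \<open>2^(d*d)\<close> points, and a squared norm is at most
  \<open>d * 2^(2*d)\<close>, which is below \<open>2^(3*d)\<close>; some norm is therefore attained
  often. The assumption on \<open>d\<close> keeps the subtraction in the exponent from being
  truncated.\<close>

lemma large_sphere:
  assumes "3 \<le> d"
  defines "W \<equiv> {..<d} \<rightarrow>\<^sub>E {0..<2 ^ d :: int}"
  obtains R where "2 ^ (d * d - 3 * d) \<le> card {b \<in> W. (\<Sum>c<d. (b c)\<^sup>2) = R}"
proof -
  let ?g = "\<lambda>b. \<Sum>c<d. (b c :: int)\<^sup>2"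
  have W: "finite W" "card W = 2 ^ (d * d)"
    unfolding W_def by (auto simp: card_PiE finite_PiE nat_power_eq simp flip: power_mult)
  have "?g b \<in> {0..<2 ^ (3 * d)}" if b: "b \<in> W" for b
  proof -
    have "(b c)\<^sup>2 \<le> 2 ^ (2 * d)" if "c < d" for c
    proof -
      have "0 \<le> b c" "b c \<le> 2 ^ d" using b that unfolding W_def by (auto dest!: PiE_mem[of _ _ _ c])
      then have "(b c)\<^sup>2 \<le> (2 ^ d)\<^sup>2" by (intro power_mono)
      then show ?thesis by (simp add: mult.commute flip: power_mult)
    qed
    then have "?g b \<le> (\<Sum>c<d. 2 ^ (2 * d))" by (intro sum_mono) auto
    also have "\<dots> = int d * 2 ^ (2 * d)" by simp
    also have "\<dots> < 2 ^ d * 2 ^ (2 * d)"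
    proof -
      have "int d < int (2 ^ d)" unfolding of_nat_less_iff by (rule less_exp)
      then show ?thesis by simp
    qed
    also have "\<dots> = 2 ^ (3 * d)" by (simp flip: power_add)
    finally show ?thesis by (simp add: sum_nonneg)
  qed
  then have "\<exists>R\<in>{0..<2 ^ (3 * d)}. card W \<le> card (?g -` {R} \<inter> W) * card {0..<2 ^ (3 * d) :: int}"
    using W(1) by (intro pigeonhole_card) auto
  then obtain R where "card W \<le> card (?g -` {R} \<inter> W) * 2 ^ (3 * d)"
    by (auto simp: nat_power_eq)
  moreover have "?g -` {R} \<inter> W = {b \<in> W. ?g b = R}" by auto
  moreover have "d * d = (d * d - 3 * d) + 3 * d" using assms(1) by simp
  then have "(2::nat) ^ (d * d) = 2 ^ (d * d - 3 * d) * 2 ^ (3 * d)"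
    by (metis power_add)
  ultimately have "2 ^ (d * d - 3 * d) * 2 ^ (3 * d) \<le> card {b \<in> W. ?g b = R} * 2 ^ (3 * d)"
    using W(2) by simp
  then have "2 ^ (d * d - 3 * d) \<le> card {b \<in> W. ?g b = R}" by simp
  then show thesis by (rule that)
qed

lemma card_bit_strings: "card {s :: bool list. length s = n} = 2 ^ n"
  using card_lists_length_eq[of "UNIV :: bool set" n] by simp

lemma finite_bit_strings: "finite {s :: bool list. length s = n}"
  using finite_lists_length_eq[of "UNIV :: bool set" n] by simp

text \<open>Pure counting: \<open>d*d\<close> bits fit into \<open>a\<close> and
  \<open>d*d - 3*d\<close> into \<open>b\<close>, so some injection exists. It need not be explicit,
  since protocols may use arbitrary functions of the input.\<close>

lemma sphere_encoding:
  assumes "3 \<le> d"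
  obtains a b :: "bool list \<Rightarrow> nat \<Rightarrow> int" and R
  where "\<And>s c. length s = 2 * d * d - 3 * d \<Longrightarrow> c < d \<Longrightarrow> a s c \<in> {0..<2 ^ d} \<and> b s c \<in> {0..<2 ^ d}"
    "\<And>s. length s = 2 * d * d - 3 * d \<Longrightarrow> (\<Sum>c<d. (b s c)\<^sup>2) = R"
    "\<And>s t. length s = 2 * d * d - 3 * d \<Longrightarrow> length t = 2 * d * d - 3 * d \<Longrightarrow>
      (\<forall>c<d. a s c = a t c \<and> b s c = b t c) \<Longrightarrow> s = t"
proof -
  let ?n = "2 * d * d - 3 * d" and ?W = "{..<d} \<rightarrow>\<^sub>E {0..<2 ^ d :: int}"
  obtain R where R: "2 ^ (d * d - 3 * d) \<le> card {b \<in> ?W. (\<Sum>c<d. (b c)\<^sup>2) = R}"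
    using large_sphere[OF assms] by blast
  let ?B = "{b \<in> ?W. (\<Sum>c<d. (b c)\<^sup>2) = R}"
  have W: "finite ?W" "card ?W = 2 ^ (d * d)"
    by (auto simp: card_PiE finite_PiE nat_power_eq simp flip: power_mult)
  have "card {s :: bool list. length s = ?n} = 2 ^ (d * d + (d * d - 3 * d))"
    using assms by (simp add: card_bit_strings)
  also have "\<dots> \<le> card (?W \<times> ?B)"
    using W(2) R by (simp add: card_cartesian_product power_add)
  finally have "\<exists>\<phi>. \<phi> ` {s :: bool list. length s = ?n} \<subseteq> ?W \<times> ?B \<and> inj_on \<phi> {s. length s = ?n}"
    using W(1) finite_bit_strings by (intro card_le_inj) auto
  then obtain \<phi> where \<phi>: "\<phi> ` {s :: bool list. length s = ?n} \<subseteq> ?W \<times> ?B"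
    "inj_on \<phi> {s. length s = ?n}" by blast
  have mem: "fst (\<phi> s) \<in> ?W" "snd (\<phi> s) \<in> ?B" if "length s = ?n" for s
    using \<phi>(1) that by (auto simp: image_subset_iff mem_Times_iff)
  show thesis
  proof (rule that[of "\<lambda>s. fst (\<phi> s)" "\<lambda>s. snd (\<phi> s)" R])
    fix s :: "bool list" and c assume "length s = ?n" "c < d"
    then show "fst (\<phi> s) c \<in> {0..<2 ^ d} \<and> snd (\<phi> s) c \<in> {0..<2 ^ d}"
      using mem[of s] PiE_mem[of _ "{..<d}" _ c] by blast
  next
    fix s :: "bool list" assume "length s = ?n"
    then show "(\<Sum>c<d. (snd (\<phi> s) c)\<^sup>2) = R" using mem[of s] by simp
  next
    fix s t :: "bool list"
    assume len: "length s = ?n" "length t = ?n"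
      and eq: "\<forall>c<d. fst (\<phi> s) c = fst (\<phi> t) c \<and> snd (\<phi> s) c = snd (\<phi> t) c"
    \<comment> \<open>Elements of \<open>?W\<close> are extensional, so agreement on the coordinates
      below \<open>d\<close> is equality of functions.\<close>
    have "fst (\<phi> s) = fst (\<phi> t)"
      using mem[OF len(1)] mem[OF len(2)] eq by (intro PiE_ext[of _ "{..<d}"]) auto
    moreover have "snd (\<phi> s) = snd (\<phi> t)"
      using mem[OF len(1)] mem[OF len(2)] eq by (intro PiE_ext[of _ "{..<d}"]) auto
    ultimately show "s = t" using inj_onD[OF \<phi>(2)] len by (simp add: prod_eq_iff)
  qed
qed

section \<open>From comparisons of vectors to tests of bits\<close>

definition bit_tests ::
    "('v \<times> 'v \<times> nat) list \<Rightarrow> nat \<Rightarrow> (nat \<Rightarrow> bool list \<Rightarrow> bool list) \<Rightarrow> ('v \<times> 'v \<times> (bool list \<Rightarrow> bool)) list" where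
  "bit_tests T L y = concat (map (\<lambda>(u, v, l). map (\<lambda>k. (u, v, \<lambda>s. y l s ! k)) [0..<L]) T)"

lemma length_bit_tests: "length (bit_tests T L y) = length T * L"
  by (induction T) (auto simp: bit_tests_def)

lemma solvable_within_bit_tests:
  fixes T :: "('v \<times> 'v \<times> nat) list" and y :: "nat \<Rightarrow> bool list \<Rightarrow> bool list"
  assumes "simple_graph V E" "\<And>u v l. (u, v, l) \<in> set T \<Longrightarrow> {u, v} \<in> E"
    and y: "\<And>u v l s. (u, v, l) \<in> set T \<Longrightarrow> length s = n \<Longrightarrow> length (y l s) = L"
    and determined: "\<And>x. x \<in> inputs V n \<Longrightarrow>
      (\<And>u v l. (u, v, l) \<in> set T \<Longrightarrow> y l (x u) = y l (x v)) \<Longrightarrow> (\<forall>u\<in>V. \<forall>w\<in>V. x u = x w)"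
    and "\<And>a b. (a, b) \<in> set D \<Longrightarrow> {a, b} \<in> E" "\<And>u. u \<in> V \<Longrightarrow> V \<subseteq> spread D {u}"
  shows "solvable_within n V E (length T * L + length D)"
  unfolding length_bit_tests[of T L y, symmetric]
proof (rule solvable_within_tests[OF assms(1)])
  show "{u, v} \<in> E" if "(u, v, f) \<in> set (bit_tests T L y)" for u v f
    using that assms(2) by (auto simp: bit_tests_def)
next
  fix x
  assume x: "x \<in> inputs V n"
    and pass: "\<And>u v f. (u, v, f) \<in> set (bit_tests T L y) \<Longrightarrow> f (x u) = f (x v)"
  show "\<forall>u\<in>V. \<forall>w\<in>V. x u = x w"
  proof (rule determined[OF x])
    fix u v l assume uvl: "(u, v, l) \<in> set T"
    have "u \<in> V \<and> v \<in> V" using assms(1) assms(2)[OF uvl] unfolding simple_graph_def by blast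
    then have "length (x u) = n" "length (x v) = n" using x by (simp_all add: inputs_def)
    then have len: "length (y l (x u)) = L" "length (y l (x v)) = L" using y[OF uvl] by blast+
    have "y l (x u) ! k = y l (x v) ! k" if "k < L" for k
    proof (rule pass[of u v "\<lambda>s. y l s ! k"])
      show "(u, v, \<lambda>s. y l s ! k) \<in> set (bit_tests T L y)"
        unfolding bit_tests_def set_concat set_map using uvl that
        by (intro UN_I imageI[of "(u, v, l)"]) auto
    qed
    then show "y l (x u) = y l (x v)" by (intro nth_equalityI) (simp_all only: len)
  qed
qed (use assms in auto)

text \<open>The factor 1/2 appears here: each comparison costs \<open>(k + d) * d\<close> bits,
  while the inputs have \<open>2 * d * d - 3 * d\<close>.\<close>

lemma solvable_within_sphere:
  assumes graph: "simple_graph V E" and T: "rigid V T V" "\<And>u v l. (u, v, l) \<in> set T \<Longrightarrow> {u, v} \<in> E"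
    and label: "\<And>u v l. (u, v, l) \<in> set T \<Longrightarrow> l < 2 ^ k"
    and D: "\<And>a b. (a, b) \<in> set D \<Longrightarrow> {a, b} \<in> E" "\<And>u. u \<in> V \<Longrightarrow> V \<subseteq> spread D {u}"
    and d: "3 \<le> d"
  shows "solvable_within (2 * d * d - 3 * d) V E (length T * ((k + d) * d) + length D)"
proof -
  let ?n = "2 * d * d - 3 * d"
  obtain a b :: "bool list \<Rightarrow> nat \<Rightarrow> int" and R
    where ab: "\<And>s c. length s = ?n \<Longrightarrow> c < d \<Longrightarrow> a s c \<in> {0..<2 ^ d} \<and> b s c \<in> {0..<2 ^ d}"
      and norm: "\<And>s. length s = ?n \<Longrightarrow> (\<Sum>c<d. (b s c)\<^sup>2) = R"
      and inj: "\<And>s t. length s = ?n \<Longrightarrow> length t = ?n \<Longrightarrow>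
        (\<forall>c<d. a s c = a t c \<and> b s c = b t c) \<Longrightarrow> s = t"
    by (rule sphere_encoding[OF d]) blast
  \<comment> \<open>With labels below \<open>2^k\<close>, each coordinate of
    \<open>a + l * b\<close> lies below \<open>(l + 1) * 2^d\<close>, hence below
    \<open>2^(k + d)\<close>. Encoding injectively into bit strings makes comparing the bits as good
    as comparing the vectors.\<close>
  let ?Y = "{..<d} \<rightarrow>\<^sub>E {0..<2 ^ (k + d) :: int}"
  have "finite ?Y" "card ?Y = card {s :: bool list. length s = (k + d) * d}"
    unfolding card_bit_strings
    by (auto simp: card_PiE finite_PiE nat_power_eq simp flip: power_mult)
  then obtain enc where enc: "enc ` ?Y \<subseteq> {s :: bool list. length s = (k + d) * d}" "inj_on enc ?Y"
    using card_le_inj[of ?Y "{s :: bool list. length s = (k + d) * d}"] finite_bit_strings by auto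
  define z where "z l s = (\<lambda>c\<in>{..<d}. a s c + int l * b s c)" for l :: nat and s
  have z: "z l s \<in> ?Y" if "length s = ?n" "(u, v, l) \<in> set T" for u v l s
    unfolding z_def
  proof (rule restrict_PiE_iff[THEN iffD2], intro ballI)
    fix c assume "c \<in> {..<d}"
    then have c: "0 \<le> a s c" "a s c < 2 ^ d" "0 \<le> b s c" "b s c < 2 ^ d"
      using ab[OF that(1), of c] by auto
    have "int (l + 1) \<le> int (2 ^ k)" using label[OF that(2)] unfolding of_nat_le_iff by simp
    then have "int l + 1 \<le> 2 ^ k" by simp
    have "a s c + int l * b s c < 2 ^ d + int l * 2 ^ d"
      using c by (intro add_less_le_mono mult_left_mono) auto
    also have "\<dots> = (int l + 1) * 2 ^ d" by (simp add: algebra_simps)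
    also have "\<dots> \<le> 2 ^ k * 2 ^ d"
      using \<open>int l + 1 \<le> 2 ^ k\<close> by (intro mult_right_mono) auto
    finally show "a s c + int l * b s c \<in> {0..<2 ^ (k + d)}"
      using c by (simp add: power_add)
  qed
  show ?thesis
  proof (rule solvable_within_bit_tests[OF graph T(2), where y = "\<lambda>l s. enc (z l s)"])
    show "length (enc (z l s)) = (k + d) * d"
      if "(u, v, l) \<in> set T" "length s = ?n" for u v l s
      using z[OF that(2,1)] enc(1) by blast
  next
    fix x assume x: "x \<in> inputs V ?n"
      and pass: "\<And>u v l. (u, v, l) \<in> set T \<Longrightarrow> enc (z l (x u)) = enc (z l (x v))"
    have len: "length (x v) = ?n" if "v \<in> V" for v using x that by (simp add: inputs_def)
    have agree: "\<forall>c<d. a (x u) c + int l * b (x u) c = a (x v) c + int l * b (x v) c"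
      if uvl: "(u, v, l) \<in> set T" for u v l
    proof -
      have "{u, v} \<subseteq> V" using graph T(2)[OF uvl] unfolding simple_graph_def by blast
      then have "z l (x u) \<in> ?Y" "z l (x v) \<in> ?Y" using z[OF len uvl] by auto
      then have eq: "z l (x u) = z l (x v)" using inj_onD[OF enc(2), OF pass[OF uvl]] by blast
      show ?thesis
      proof (intro allI impI)
        fix c assume "c < d"
        then show "a (x u) c + int l * b (x u) c = a (x v) c + int l * b (x v) c"
          using fun_cong[OF eq, of c] by (simp add: z_def)
      qed
    qed
    have "\<forall>u\<in>V. \<forall>v\<in>V. \<forall>c<d. a (x u) c = a (x v) c \<and> b (x u) c = b (x v) c"
      using T(1)[unfolded rigid_def, THEN spec[of _ "\<lambda>v. a (x v)"], THEN spec[of _ "\<lambda>v. b (x v)"],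
          THEN spec[of _ d], THEN spec[of _ R]] norm[OF len] agree by blast
    then show "\<forall>u\<in>V. \<forall>w\<in>V. x u = x w" using inj len by blast
  qed (use D in auto)
qed

text \<open>A crude protocol for every length, sending whole strings across all comparisons. It
  guarantees that the minimum defining \<open>equality_cost\<close> is attained, which subadditivity
  needs for all lengths. Rigidity is applied to the bits as \<open>a\<close>, with
  \<open>b = 0\<close> and \<open>R = 0\<close>.\<close>

lemma solvable_within_exists:
  assumes graph: "simple_graph V E" and T: "rigid V T V" "\<And>u v l. (u, v, l) \<in> set T \<Longrightarrow> {u, v} \<in> E"
    and D: "\<And>a b. (a, b) \<in> set D \<Longrightarrow> {a, b} \<in> E" "\<And>u. u \<in> V \<Longrightarrow> V \<subseteq> spread D {u}"
  shows "solvable_within n V E (length T * n + length D)"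
proof (rule solvable_within_bit_tests[OF graph T(2), where y = "\<lambda>l s. s"])
  fix x assume x: "x \<in> inputs V n" and pass: "\<And>u v l. (u, v, l) \<in> set T \<Longrightarrow> x u = x v"
  let ?a = "\<lambda>v c. if x v ! c then 1 else 0 :: int"
  have "\<forall>u\<in>V. \<forall>v\<in>V. \<forall>c<n. ?a u c = ?a v c"
    using T(1)[unfolded rigid_def, THEN spec[of _ ?a], THEN spec[of _ "\<lambda>_ _. 0"],
        THEN spec[of _ n], THEN spec[of _ 0]] pass by fastforce
  then have bits: "x u ! c = x v ! c" if "u \<in> V" "v \<in> V" "c < n" for u v c
    using that by (metis zero_neq_one)
  have len: "length (x u) = n" if "u \<in> V" for u
    using x that by (simp add: inputs_def)
  show "\<forall>u\<in>V. \<forall>w\<in>V. x u = x w"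
  proof (intro ballI nth_equalityI)
    fix u w c assume uw: "u \<in> V" "w \<in> V" and "c < length (x u)"
    then show "x u ! c = x w ! c" by (intro bits) (simp_all only: len)
  qed (simp only: len)
qed (use D in auto)

section \<open>The limiting rate\<close>

lemma sphere_rate_limit:
  fixes t k D :: nat
  shows "(\<lambda>d. real (t * ((k + d) * d) + D) / real (2 * d * d - 3 * d)) \<longlonglongrightarrow> 1 / 2 * real t"
proof -
  have "(\<lambda>d. (real t * (real k / real d + 1) + real D / real d * (1 / real d)) / (2 - 3 / real d))
      \<longlonglongrightarrow> (real t * (0 + 1) + 0 * 0) / (2 - 0)"
    by (intro tendsto_intros lim_const_over_n) auto
  moreover have "\<forall>\<^sub>F d in sequentially.
      (real t * (real k / real d + 1) + real D / real d * (1 / real d)) / (2 - 3 / real d) =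
      real (t * ((k + d) * d) + D) / real (2 * d * d - 3 * d)"
    unfolding eventually_sequentially
  proof (intro exI[of _ 3] allI impI)
    fix d :: nat assume d: "3 \<le> d"
    have "3 * d \<le> 2 * d * d" using d by (intro mult_right_mono) auto
    then have "real (2 * d * d - 3 * d) = (2 - 3 / real d) * (real d * real d)"
      using d by (simp add: of_nat_diff field_simps)
    moreover have "real (t * ((k + d) * d) + D) =
        (real t * (real k / real d + 1) + real D / real d * (1 / real d)) * (real d * real d)"
      using d by (simp add: field_simps)
    ultimately show "(real t * (real k / real d + 1) + real D / real d * (1 / real d)) / (2 - 3 / real d) =
      real (t * ((k + d) * d) + D) / real (2 * d * d - 3 * d)"
      using d by simp
  qed
  ultimately show ?thesis by (simp add: tendsto_cong)
qed

theorem theorem2p2: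
  fixes V :: "'v set" and E :: "'v set set"
  assumes "simple_graph V E" and "graph_connected V E"
  shows "equality_rate V E \<le> 1 / 2 * real (c2 V E)"
proof -
  have V: "finite V" "\<And>e. e \<in> E \<Longrightarrow> e \<subseteq> V" using assms(1) unfolding simple_graph_def by auto
  obtain M where M: "size M = c2 V E" "set_mset M \<subseteq> E" "two_edge_connected V M"
    by (rule c2_attained[OF assms])
  obtain T where T: "rigid V T V" "length T \<le> size M" "\<And>u v l. (u, v, l) \<in> set T \<Longrightarrow> {u, v} \<in># M"
    using rigid_exists[OF V(1) M(3)] V(2) M(2) by blast
  have TE: "{u, v} \<in> E" if "(u, v, l) \<in> set T" for u v l using T(3)[OF that] M(2) by blast
  obtain D where D: "\<And>a b. (a, b) \<in> set D \<Longrightarrow> {a, b} \<in> E" "\<And>u. u \<in> V \<Longrightarrow> V \<subseteq> spread D {u}"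
    using broadcast_exists[OF V(1) assms(2)] by blast
  \<comment> \<open>Any bound on the labels will do, as \<open>k\<close> stays fixed while
    \<open>d\<close> grows; their sum is one.\<close>
  define k where "k = (\<Sum>(u, v, l)\<leftarrow>T. l)"
  have label: "l < 2 ^ k" if "(u, v, l) \<in> set T" for u v l
  proof -
    have "l \<le> k" unfolding k_def using that by (intro member_le_sum_list) (force, simp)
    also have "k < 2 ^ k" by (rule less_exp)
    finally show ?thesis .
  qed
  let ?f = "\<lambda>n. real (equality_cost n V E)"
  have opt: "solvable_within n V E (equality_cost n V E)" for n
    using solvable_within_equality_cost[OF assms(1) solvable_within_exists[OF assms(1) T(1) TE D]] .
  have "?f (m + n) \<le> ?f m + ?f n" for m n
    using equality_cost_le[OF assms(1) solvable_within_add[OF assms(1) opt opt]]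
    by (simp flip: of_nat_add)
  then obtain L where L: "(\<lambda>n. ?f n / real n) \<longlonglongrightarrow> L" "\<And>n. 1 \<le> n \<Longrightarrow> L \<le> ?f n / real n"
    using fekete[of ?f] by auto
  \<comment> \<open>Only the lengths \<open>2 * d * d - 3 * d\<close> are examined. Since
    \<open>L\<close> is a lower bound for every quotient, it lies below the limit along this
    sequence.\<close>
  have "L \<le> real (length T * ((k + d) * d) + length D) / real (2 * d * d - 3 * d)" if d: "3 \<le> d" for d
  proof -
    let ?n = "2 * d * d - 3 * d"
    have "3 * d < 2 * d * d" using d by (intro mult_strict_right_mono) auto
    then have "1 \<le> ?n" by linarith
    then have "L \<le> ?f ?n / real ?n" by (rule L(2))
    also have "\<dots> \<le> real (length T * ((k + d) * d) + length D) / real ?n"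
      using equality_cost_le[OF assms(1) solvable_within_sphere[OF assms(1) T(1) TE label D d]]
      by (intro divide_right_mono) (auto simp only: of_nat_le_iff of_nat_0_le_iff)
    finally show ?thesis .
  qed
  then have "L \<le> 1 / 2 * real (length T)"
    by (intro LIMSEQ_le_const[OF sphere_rate_limit]) blast
  also have "\<dots> \<le> 1 / 2 * real (c2 V E)" using T(2) M(1) by simp
  finally show ?thesis unfolding equality_rate_def limI[OF L(1)] .
qed

end
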